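(* Let $G$ be a finitely presented group, $\phi\in\mathrm{Via}(G)$ and $\mathcal{K}\in\{\mathrm{Fin},\mathrm{Coset},\mathrm{Rec},\mathrm{CF}\}$ be a class of subsets. If $G^\phi$ is $\mathcal{K}$-generalized conjugacy separable, then $G$ is $\mathcal{K}$-generalized $\phi$-twisted conjugacy separable.
   Context: Maps are written on the right. The profinite topology on a group has as basis the cosets of finite index subgroups; a subset is separable if it is closed in this topology. An automorphism $\phi$ of $G$ is virtually inner if some positive power of it is inner; $\mathrm{Via}(G)$ is the set of virtually inner automorphisms of $G$. The group $G^\phi$: let $G=\langle A\mid R\rangle$ and let $\phi\in\mathrm{Via}(G)$ be such that, for a positive integer $p_\phi$ and an element $\Delta_\phi\in G$, the power $\phi^{p_\phi}$ is the inner automorphism given by $x\phi^{p_\phi}=\Delta_\phi^{-1}x\Delta_\phi$ for all $x\in G$. Define $$G^\phi=\langle A,t\mid R,\ t^{-1}at=a\phi\ (a\in A),\ t^{p_\phi}=\Delta_\phi\rangle .$$ Classes of subsets of a finitely generated group $G=\langle A\rangle$ ($A$ finite), with $\widetilde A=A\cup A^{-1}$ and canonical surjective homomorphism $\pi:\widetilde A^*\to G$: $\mathrm{Fin}(G)$ is the class of finite subsets; $\mathrm{Coset}(G)$ the class of cosets of finitely generated subgroups; $\mathrm{Rec}(G)$ the class of subsets $K$ with $K\pi^{-1}$ a rational language; $\mathrm{CF}(G)$ the class of subsets $K$ with $K\pi^{-1}$ a context-free language. These do not depend on the choice of $A$. A group $G$ is $\mathcal{K}$-generalized conjugacy separable if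 $\{x^{-1}sx\mid x\in G,\ s\in K\}$ is separable for all $K\in\mathcal{K}(G)$; it is $\mathcal{K}$-generalized $\phi$-twisted conjugacy separable if $\{(x^{-1}\phi)sx\mid x\in G,\ s\in K\}$ is separable for all $K\in\mathcal{K}(G)$. *)

theory Defs
  imports
    "HOL-Algebra.Generated_Groups"
    "HOL-Analysis.Abstract_Topology"
begin

section \<open>Words and group presentations\<close>

text \<open>The letter \<open>(a, True)\<close> stands for \<open>a\<close> and \<open>(a, False)\<close> for its formal inverse, so that
  \<open>words A\<close> is the free monoid on the alphabet \<open>A \<union> A\<inverse>\<close>.\<close>

type_synonym 'x word = "('x \<times> bool) list"

definition words :: "'x set \<Rightarrow> 'x word set" where
  "words A = lists (A \<times> UNIV)"

text \<open>Equality of words in the group \<open>\<langle>A | R\<rangle>\<close>, for a set \<open>R\<close> of pairs \<open>(u, v)\<close>, each read as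
  the defining relation \<open>u = v\<close>: the least monoid congruence on \<open>words A\<close> that
  contains \<open>R\<close> and the cancellation of inverse letters.\<close>

inductive pres_eq :: "'x set \<Rightarrow> ('x word \<times> 'x word) set \<Rightarrow> 'x word \<Rightarrow> 'x word \<Rightarrow> bool"
  for A R where
  pres_eq_refl: "w \<in> words A \<Longrightarrow> pres_eq A R w w"
| pres_eq_sym: "pres_eq A R u v \<Longrightarrow> pres_eq A R v u"
| pres_eq_trans: "pres_eq A R u v \<Longrightarrow> pres_eq A R v w \<Longrightarrow> pres_eq A R u w"
| pres_eq_append: "pres_eq A R u u' \<Longrightarrow> pres_eq A R v v' \<Longrightarrow> pres_eq A R (u @ v) (u' @ v')"
| pres_eq_cancel: "a \<in> A \<Longrightarrow> pres_eq A R [(a, b), (a, \<not> b)] []"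
| pres_eq_rel: "(u, v) \<in> R \<Longrightarrow> u \<in> words A \<Longrightarrow> v \<in> words A \<Longrightarrow> pres_eq A R u v"

definition word_class :: "'x set \<Rightarrow> ('x word \<times> 'x word) set \<Rightarrow> 'x word \<Rightarrow> 'x word set" where
  "word_class A R w = {u. pres_eq A R w u}"

definition presented_group :: "'x set \<Rightarrow> ('x word \<times> 'x word) set \<Rightarrow> 'x word set monoid" where
  "presented_group A R =
     \<lparr>carrier = word_class A R ` words A,
      mult = (\<lambda>X Y. \<Union>u\<in>X. \<Union>v\<in>Y. word_class A R (u @ v)),
      one = word_class A R []\<rparr>"

text \<open>\<open>G = \<langle>A | R\<rangle>\<close> with \<open>A\<close> and \<open>R\<close> finite; the identification of \<open>G\<close> with the presented group is
  the isomorphism \<open>f\<close>.\<close>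

definition finite_presentation ::
    "('g, 'm) monoid_scheme \<Rightarrow> 'x set \<Rightarrow> ('x word \<times> 'x word) set \<Rightarrow> ('x word set \<Rightarrow> 'g) \<Rightarrow> bool" where
  "finite_presentation G A R f \<longleftrightarrow>
     finite A \<and> finite R \<and> R \<subseteq> words A \<times> words A \<and> f \<in> iso (presented_group A R) G"

lemma words_simps [simp]:
  "[] \<in> words A"
  "x # w \<in> words A \<longleftrightarrow> fst x \<in> A \<and> w \<in> words A"
  "u @ v \<in> words A \<longleftrightarrow> u \<in> words A \<and> v \<in> words A"
  by (auto simp: words_def mem_Times_iff)

lemma pres_eq_words: "pres_eq A R u v \<Longrightarrow> u \<in> words A \<and> v \<in> words A"
  by (induction rule: pres_eq.induct) auto

lemma word_class_eq_iff:
  assumes "u \<in> words A"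
  shows "word_class A R u = word_class A R v \<longleftrightarrow> pres_eq A R u v"
proof
  assume "word_class A R u = word_class A R v"
  then have "pres_eq A R v u"
    using pres_eq_refl[OF assms] unfolding word_class_def by blast
  then show "pres_eq A R u v" by (rule pres_eq_sym)
next
  assume "pres_eq A R u v"
  then show "word_class A R u = word_class A R v"
    unfolding word_class_def by (blast intro: pres_eq_trans[OF pres_eq_sym] pres_eq_trans)
qed

lemma mult_presented_group:
  assumes "u \<in> words A" "v \<in> words A"
  shows "word_class A R u \<otimes>\<^bsub>presented_group A R\<^esub> word_class A R v = word_class A R (u @ v)"
proof -
  have "word_class A R (u' @ v') = word_class A R (u @ v)"
    if "u' \<in> word_class A R u" "v' \<in> word_class A R v" for u' v'
  proof -
    have "pres_eq A R (u @ v) (u' @ v')"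
      using that by (simp add: word_class_def pres_eq_append)
    then show ?thesis
      using assms word_class_eq_iff[of "u @ v" A R "u' @ v'"] by simp
  qed
  moreover have "u \<in> word_class A R u" "v \<in> word_class A R v"
    using assms by (simp_all add: word_class_def pres_eq_refl)
  ultimately have "(\<Union>u'\<in>word_class A R u. \<Union>v'\<in>word_class A R v. word_class A R (u' @ v')) =
      word_class A R (u @ v)"
    by blast
  then show ?thesis
    by (simp add: presented_group_def)
qed

lemma group_presented_group: "group (presented_group A R)"
proof (rule groupI)
  let ?P = "presented_group A R"
  have carr: "carrier ?P = word_class A R ` words A" and one: "\<one>\<^bsub>?P\<^esub> = word_class A R []"
    by (simp_all add: presented_group_def)
  show "\<one>\<^bsub>?P\<^esub> \<in> carrier ?P"
    unfolding carr one by simp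
  fix X assume "X \<in> carrier ?P"
  then obtain u where u: "u \<in> words A" "X = word_class A R u"
    by (auto simp: carr)
  then show "\<one>\<^bsub>?P\<^esub> \<otimes>\<^bsub>?P\<^esub> X = X"
    by (simp add: one mult_presented_group)
  have "\<exists>v\<in>words A. pres_eq A R (v @ u) []"
    using u(1)
  proof (induction u)
    case Nil
    then show ?case by (intro bexI[of _ "[]"]) (simp_all add: pres_eq_refl)
  next
    case (Cons x u)
    obtain a b where x: "x = (a, b)" by force
    from Cons obtain v where v: "v \<in> words A" "pres_eq A R (v @ u) []" by auto
    have u: "u \<in> words A" and a: "a \<in> A" using Cons.prems x by auto
    have "pres_eq A R [(a, \<not> b), (a, b)] []"
      using pres_eq_cancel[OF a, of R "\<not> b"] by simp
    from pres_eq_append[OF pres_eq_append[OF pres_eq_refl[OF v(1)] this] pres_eq_refl[OF u]]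
    have "pres_eq A R ((v @ [(a, \<not> b)]) @ x # u) (v @ u)"
      by (simp add: x)
    then have "pres_eq A R ((v @ [(a, \<not> b)]) @ x # u) []"
      using v(2) by (rule pres_eq_trans)
    with v a show ?case
      by (intro bexI[of _ "v @ [(a, \<not> b)]"]) simp_all
  qed
  then obtain v where v: "v \<in> words A" "pres_eq A R (v @ u) []" by blast
  show "\<exists>Y\<in>carrier ?P. Y \<otimes>\<^bsub>?P\<^esub> X = \<one>\<^bsub>?P\<^esub>"
  proof (rule bexI)
    show "word_class A R v \<otimes>\<^bsub>?P\<^esub> X = \<one>\<^bsub>?P\<^esub>"
      using u v by (simp add: one mult_presented_group word_class_eq_iff)
    show "word_class A R v \<in> carrier ?P"
      unfolding carr using v(1) by (rule imageI)
  qed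
  fix Y assume "Y \<in> carrier ?P"
  then obtain w where w: "w \<in> words A" "Y = word_class A R w"
    by (auto simp: carr)
  show "X \<otimes>\<^bsub>?P\<^esub> Y \<in> carrier ?P"
    using u w by (simp add: carr mult_presented_group)
  fix Z assume "Z \<in> carrier ?P"
  then obtain z where "z \<in> words A" "Z = word_class A R z"
    by (auto simp: carr)
  then show "X \<otimes>\<^bsub>?P\<^esub> Y \<otimes>\<^bsub>?P\<^esub> Z = X \<otimes>\<^bsub>?P\<^esub> (Y \<otimes>\<^bsub>?P\<^esub> Z)"
    using u w by (simp add: mult_presented_group)
qed


section \<open>Virtually inner automorphisms and the group \<open>G\<^sup>\<phi>\<close>\<close>

definition inner_by :: "('g, 'm) monoid_scheme \<Rightarrow> 'g \<Rightarrow> ('g \<Rightarrow> 'g) \<Rightarrow> bool" where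
  "inner_by G g \<psi> \<longleftrightarrow> g \<in> carrier G \<and> (\<forall>x\<in>carrier G. \<psi> x = inv\<^bsub>G\<^esub> g \<otimes>\<^bsub>G\<^esub> x \<otimes>\<^bsub>G\<^esub> g)"

definition Via :: "('g, 'm) monoid_scheme \<Rightarrow> ('g \<Rightarrow> 'g) set" where
  "Via G = {\<phi> \<in> iso G G. \<exists>p>0. \<exists>g. inner_by G g (\<phi> ^^ p)}"

text \<open>In \<open>G_phi\<close> the letters of \<open>A\<close> become \<open>Some a\<close>, and the new letter \<open>t\<close> is \<open>None\<close>.
  The right-hand sides \<open>a\<phi>\<close> and \<open>\<Delta>\<close> of the relations are elements of \<open>G\<close>, to be spelled as words
  over \<open>A\<close>; rather than choosing a spelling, we include the relation for each of them. Two
  spellings of the same element are already equal modulo \<open>R\<close>, so this presents the same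
  group as any single choice.\<close>

definition lift_word :: "'x word \<Rightarrow> 'x option word" where
  "lift_word = map (map_prod Some id)"

definition G_phi :: "'x set \<Rightarrow> ('x word \<times> 'x word) set \<Rightarrow> ('x word set \<Rightarrow> 'g) \<Rightarrow>
    ('g \<Rightarrow> 'g) \<Rightarrow> nat \<Rightarrow> 'g \<Rightarrow> 'x option word set monoid" where
  "G_phi A R f \<phi> p \<Delta> = presented_group (insert None (Some ` A))
     (map_prod lift_word lift_word ` R \<union>
      {([(None, False), (Some a, True), (None, True)], lift_word w) | a w.
         a \<in> A \<and> w \<in> words A \<and> f (word_class A R w) = \<phi> (f (word_class A R [(a, True)]))} \<union>
      {(replicate p (None, True), lift_word w) | w.
         w \<in> words A \<and> f (word_class A R w) = \<Delta>})"


section \<open>Rational and context-free languages\<close>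

inductive rational :: "'l list set \<Rightarrow> bool" where
  rational_empty: "rational {}"
| rational_single: "rational {w}"
| rational_union: "rational L \<Longrightarrow> rational M \<Longrightarrow> rational (L \<union> M)"
| rational_concat: "rational L \<Longrightarrow> rational M \<Longrightarrow> rational {u @ v | u v. u \<in> L \<and> v \<in> M}"
| rational_star: "rational L \<Longrightarrow> rational {concat ws | ws. ws \<in> lists L}"

text \<open>A grammar is a finite set of productions; \<open>Inl\<close> marks nonterminals and \<open>Inr\<close> terminals.
  As only finitely many nonterminals occur, they may be taken to be natural numbers.\<close>

inductive derives :: "(nat \<times> (nat + 'l) list) set \<Rightarrow> (nat + 'l) list \<Rightarrow> (nat + 'l) list \<Rightarrow> bool"
  for P where
  derives_refl: "derives P s s"
| derives_step: "derives P s (u @ [Inl N] @ v) \<Longrightarrow> (N, r) \<in> P \<Longrightarrow> derives P s (u @ r @ v)"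

definition context_free :: "'l list set \<Rightarrow> bool" where
  "context_free L \<longleftrightarrow> (\<exists>P S. finite P \<and> L = {w. derives P [Inl S] (map Inr w)})"


section \<open>Classes of subsets of a group\<close>

fun letter_val :: "('g, 'm) monoid_scheme \<Rightarrow> 'g \<times> bool \<Rightarrow> 'g" where
  "letter_val G (a, b) = (if b then a else inv\<^bsub>G\<^esub> a)"

definition word_val :: "('g, 'm) monoid_scheme \<Rightarrow> 'g word \<Rightarrow> 'g" where
  "word_val G w = foldr (\<lambda>l x. letter_val G l \<otimes>\<^bsub>G\<^esub> x) w \<one>\<^bsub>G\<^esub>"

definition preimage_lang :: "('g, 'm) monoid_scheme \<Rightarrow> 'g set \<Rightarrow> 'g set \<Rightarrow> 'g word set" where
  "preimage_lang G A K = {w \<in> words A. word_val G w \<in> K}"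

definition finite_gen_set :: "('g, 'm) monoid_scheme \<Rightarrow> 'g set \<Rightarrow> bool" where
  "finite_gen_set G A \<longleftrightarrow> finite A \<and> A \<subseteq> carrier G \<and> generate G A = carrier G"

definition Fin_sets :: "('g, 'm) monoid_scheme \<Rightarrow> 'g set set" where
  "Fin_sets G = {K. K \<subseteq> carrier G \<and> finite K}"

definition Coset_sets :: "('g, 'm) monoid_scheme \<Rightarrow> 'g set set" where
  "Coset_sets G = {K. \<exists>S g. finite S \<and> S \<subseteq> carrier G \<and> g \<in> carrier G \<and>
     (K = generate G S #>\<^bsub>G\<^esub> g \<or> K = g <#\<^bsub>G\<^esub> generate G S)}"

text \<open>Whether the preimage language of \<open>K\<close> is rational (context-free) does not depend on the finite
  generating set, so quantifying existentially over it is harmless.\<close>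

definition Rec_sets :: "('g, 'm) monoid_scheme \<Rightarrow> 'g set set" where
  "Rec_sets G =
     {K. K \<subseteq> carrier G \<and> (\<exists>A. finite_gen_set G A \<and> rational (preimage_lang G A K))}"

definition CF_sets :: "('g, 'm) monoid_scheme \<Rightarrow> 'g set set" where
  "CF_sets G =
     {K. K \<subseteq> carrier G \<and> (\<exists>A. finite_gen_set G A \<and> context_free (preimage_lang G A K))}"

datatype subset_class = Fin | Coset | Rec | CF

fun sets_in_class :: "subset_class \<Rightarrow> ('g, 'm) monoid_scheme \<Rightarrow> 'g set set" where
  "sets_in_class Fin G = Fin_sets G"
| "sets_in_class Coset G = Coset_sets G"
| "sets_in_class Rec G = Rec_sets G"
| "sets_in_class CF G = CF_sets G"


section \<open>Profinite topology and generalized conjugacy separability\<close>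

definition finite_index :: "('g, 'm) monoid_scheme \<Rightarrow> 'g set \<Rightarrow> bool" where
  "finite_index G H \<longleftrightarrow> subgroup H G \<and> finite (rcosets\<^bsub>G\<^esub> H)"

text \<open>Right cosets suffice, since \<open>gH = (gHg\<inverse>)g\<close>.\<close>

definition fi_cosets :: "('g, 'm) monoid_scheme \<Rightarrow> 'g set set" where
  "fi_cosets G = {H #>\<^bsub>G\<^esub> g | H g. finite_index G H \<and> g \<in> carrier G}"

definition profinite_topology :: "('g, 'm) monoid_scheme \<Rightarrow> 'g topology" where
  "profinite_topology G = topology (arbitrary union_of (\<lambda>U. U \<in> fi_cosets G))"

definition separable :: "('g, 'm) monoid_scheme \<Rightarrow> 'g set \<Rightarrow> bool" where
  "separable G S \<longleftrightarrow> closedin (profinite_topology G) S"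

definition gen_conjugacy_separable :: "subset_class \<Rightarrow> ('g, 'm) monoid_scheme \<Rightarrow> bool" where
  "gen_conjugacy_separable \<K> G \<longleftrightarrow> (\<forall>K\<in>sets_in_class \<K> G.
     separable G {inv\<^bsub>G\<^esub> x \<otimes>\<^bsub>G\<^esub> s \<otimes>\<^bsub>G\<^esub> x | x s. x \<in> carrier G \<and> s \<in> K})"

definition gen_twisted_conjugacy_separable ::
    "subset_class \<Rightarrow> ('g, 'm) monoid_scheme \<Rightarrow> ('g \<Rightarrow> 'g) \<Rightarrow> bool" where
  "gen_twisted_conjugacy_separable \<K> G \<phi> \<longleftrightarrow> (\<forall>K\<in>sets_in_class \<K> G.
     separable G {\<phi> (inv\<^bsub>G\<^esub> x) \<otimes>\<^bsub>G\<^esub> s \<otimes>\<^bsub>G\<^esub> x | x s. x \<in> carrier G \<and> s \<in> K})"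

text \<open>The cosets do form a basis, so \<^const>\<open>profinite_topology\<close> has the intended open sets.\<close>

lemma (in group) r_coset_Int:
  assumes H: "subgroup H G" and K: "subgroup K G" and x: "x \<in> carrier G"
  shows "(H \<inter> K) #> x = (H #> x) \<inter> (K #> x)"
proof (intro equalityI subsetI)
  fix y assume "y \<in> (H \<inter> K) #> x"
  then show "y \<in> (H #> x) \<inter> (K #> x)"
    by (auto simp: r_coset_def)
next
  fix y assume "y \<in> (H #> x) \<inter> (K #> x)"
  then obtain h k where hk: "h \<in> H" "k \<in> K" "y = h \<otimes> x" "y = k \<otimes> x"
    by (auto simp: r_coset_def)
  then have "h \<otimes> x = k \<otimes> x" by simp
  then have "h = k"
    using right_cancel[OF x subgroup.mem_carrier[OF H hk(1)] subgroup.mem_carrier[OF K hk(2)]]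
    by blast
  with hk show "y \<in> (H \<inter> K) #> x"
    by (auto simp: r_coset_def)
qed

lemma (in group) finite_index_Int:
  assumes "finite_index G H" "finite_index G K"
  shows "finite_index G (H \<inter> K)"
proof -
  have H: "subgroup H G" and K: "subgroup K G"
    using assms by (simp_all add: finite_index_def)
  have "rcosets (H \<inter> K) \<subseteq> (\<lambda>(X, Y). X \<inter> Y) ` ((rcosets H) \<times> (rcosets K))"
  proof
    fix X assume "X \<in> rcosets (H \<inter> K)"
    then obtain x where x: "x \<in> carrier G" "X = (H \<inter> K) #> x"
      by (auto simp: RCOSETS_def)
    then have "X = (\<lambda>(X, Y). X \<inter> Y) (H #> x, K #> x)"
      using r_coset_Int[OF H K] by simp
    moreover have "(H #> x, K #> x) \<in> (rcosets H) \<times> (rcosets K)"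
      using x by (auto simp: RCOSETS_def)
    ultimately show "X \<in> (\<lambda>(X, Y). X \<inter> Y) ` ((rcosets H) \<times> (rcosets K))"
      by (rule image_eqI)
  qed
  then have "finite (rcosets (H \<inter> K))"
    by (rule finite_subset) (use assms in \<open>simp add: finite_index_def\<close>)
  with subgroups_Inter_pair[OF H K] show ?thesis
    by (simp add: finite_index_def)
qed

lemma (in group) openin_profinite_topology:
  "openin (profinite_topology G) = arbitrary union_of (\<lambda>U. U \<in> fi_cosets G)"
proof -
  have "(arbitrary union_of (\<lambda>U. U \<in> fi_cosets G)) (S \<inter> T)"
    if S: "S \<in> fi_cosets G" and T: "T \<in> fi_cosets G" for S T
  proof (cases "S \<inter> T = {}")
    case True
    then show ?thesis by simp
  next
    case False
    then obtain x where x: "x \<in> S" "x \<in> T" by blast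
    from S obtain H g where g: "finite_index G H" "g \<in> carrier G" "S = H #> g"
      by (auto simp: fi_cosets_def)
    from T obtain K k where k: "finite_index G K" "k \<in> carrier G" "T = K #> k"
      by (auto simp: fi_cosets_def)
    have H: "subgroup H G" and K: "subgroup K G"
      using g(1) k(1) by (simp_all add: finite_index_def)
    have "x \<in> carrier G"
      using x(1) r_coset_subset_G[OF subgroup.subset[OF H] g(2)] g(3) by blast
    moreover have "S = H #> x"
      by (rule trans[OF g(3) repr_independence[OF x(1)[unfolded g(3)] g(2) H]])
    moreover have "T = K #> x"
      by (rule trans[OF k(3) repr_independence[OF x(2)[unfolded k(3)] k(2) K]])
    ultimately have "S \<inter> T = (H \<inter> K) #> x" "x \<in> carrier G"
      using r_coset_Int[OF H K, of x] by (simp_all only:)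
    with finite_index_Int[OF g(1) k(1)] have "S \<inter> T \<in> fi_cosets G"
      unfolding fi_cosets_def by blast
    then show ?thesis
      by (rule arbitrary_union_of_inc)
  qed
  then have "istopology (arbitrary union_of (\<lambda>U. U \<in> fi_cosets G))"
    unfolding istopology_base_eq by blast
  then show ?thesis
    unfolding profinite_topology_def by (rule topology_inverse')
qed

end

theory Submission
  imports Defs
begin


text \<open>Let \<open>E = G\<^sup>\<phi>\<close> and let \<open>h\<close> be the natural map from \<open>G\<close> to \<open>E\<close>. Since \<open>h(g) t = t h(\<phi>(g))\<close>, conjugating
  \<open>t h(s)\<close> by \<open>t\<^sup>i h(x)\<close> gives \<open>t h(\<phi>(x\<^sup>-\<^sup>1) \<phi>\<^sup>i(s) x)\<close>, and \<open>\<phi>\<^sup>i(s)\<close> is twisted conjugate to \<open>s\<close>. So the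
  twisted conjugacy closure of \<open>K\<close> ought to be the preimage, under the map \<open>g \<mapsto> t h(g)\<close>, of
  the conjugacy closure of \<open>t h(K)\<close> (\<open>twisted_closure_eq_preimage\<close>). That map is continuous for
  the profinite topologies, so the theorem follows once \<open>t h(K)\<close> is known to belong to the same class
  of subsets as \<open>K\<close>.

  Two points need care. First, \<open>h\<close> is not injective in general: \<open>h(\<Delta>) = t\<^sup>p\<close> commutes with \<open>t\<close>, so
  \<open>\<phi>(\<Delta>)\<close> and \<open>\<Delta>\<close> have the same image, although \<open>\<phi>(\<Delta>) \<noteq> \<Delta>\<close> is possible. (For the infinite cyclic group,
  inversion \<open>\<phi>\<close>, \<open>p = 2\<close> and a generator \<open>\<Delta>\<close>, the group \<open>E\<close> is cyclic of order 4.) The kernel is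
  generated by the displacements \<open>\<phi>\<^sup>i(\<Delta>) \<Delta>\<^sup>-\<^sup>1\<close>. They are central because \<open>\<phi>\<^sup>i\<close> commutes with \<open>\<phi>\<^sup>p\<close>, and
  multiplying by them does not leave a twisted conjugacy class (\<open>twisted_conj_disp\<close>): twisted
  conjugation by \<open>\<Delta>\<close> turns \<open>s\<close> into \<open>\<phi>\<^sup>p(s)\<close> times the inverse of the first displacement, and
  \<open>\<phi>\<^sup>p(s)\<close> is twisted conjugate to \<open>s\<close>. Hence the preimage is the twisted closure after all. That
  the kernel is no larger is seen from an action of the words over the generators of \<open>E\<close> on the set
  of normal forms \<open>t\<^sup>i g\<close> with \<open>i < p\<close>, modulo displacements (\<open>act_pres_eq\<close>).

  Second, for recognizable and context-free \<open>K\<close> the words with value in \<open>t h(K)\<close> have to be compared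
  with the words with value in \<open>K\<close>. Pushing \<open>t\<close> through a word of \<open>E\<close> only requires remembering an
  exponent below \<open>p\<close>, so a finite transducer translates words of \<open>E\<close> into words of \<open>G\<close>; since the
  kernel of \<open>h\<close> is finitely generated, the transducer can also insert arbitrary kernel elements,
  and the language of \<open>t h(K)\<close> is exactly the inverse transduction of the language of \<open>K\<close>
  (\<open>preimage_shift\<close>). Rational languages are closed under inverse transductions by Kleene's argument,
  context-free ones by the triple construction.\<close>

section \<open>Finite transducers\<close>

text \<open>A transition \<open>(q, x, v, r)\<close> goes from \<open>q\<close> to \<open>r\<close>, reads \<open>x\<close> and writes \<open>v\<close>; both words may be
  empty.\<close>

inductive run :: "('q \<times> 'i list \<times> 'o list \<times> 'q) set \<Rightarrow> 'q \<Rightarrow> 'i list \<Rightarrow> 'o list \<Rightarrow> 'q \<Rightarrow> bool"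
  for \<delta> where
  run_Nil: "run \<delta> q [] [] q"
| run_step: "(q, x, v, r) \<in> \<delta> \<Longrightarrow> run \<delta> r w u q' \<Longrightarrow> run \<delta> q (x @ w) (v @ u) q'"

definition inverse_transduct ::
    "('q \<times> 'i list \<times> 'o list \<times> 'q) set \<Rightarrow> 'q \<Rightarrow> 'q \<Rightarrow> 'o list set \<Rightarrow> 'i list set" where
  "inverse_transduct \<delta> q q' L = {w. \<exists>v\<in>L. run \<delta> q w v q'}"

lemma run_single: "(q, x, v, r) \<in> \<delta> \<Longrightarrow> run \<delta> q x v r"
  using run_step[OF _ run_Nil, of q x v r \<delta>] by simp

lemma run_append: "run \<delta> q w v r \<Longrightarrow> run \<delta> r w' v' q' \<Longrightarrow> run \<delta> q (w @ w') (v @ v') q'"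
  by (induction rule: run.induct) (auto simp: append_assoc dest: run_step)

text \<open>If every transition writes at most one letter, a run can be cut wherever its output is cut.\<close>

definition letterwise :: "('q \<times> 'i list \<times> 'o list \<times> 'q) set \<Rightarrow> bool" where
  "letterwise \<delta> \<longleftrightarrow> (\<forall>(q, x, v, r)\<in>\<delta>. length v \<le> 1)"

lemma letterwise_cases:
  assumes "letterwise \<delta>" "(q, x, v, r) \<in> \<delta>"
  obtains "v = []" | a where "v = [a]"
  using assms by (cases v) (auto simp: letterwise_def)

lemma run_split:
  assumes "letterwise \<delta>" "run \<delta> q w (v1 @ v2) q'"
  shows "\<exists>r w1 w2. w = w1 @ w2 \<and> run \<delta> q w1 v1 r \<and> run \<delta> r w2 v2 q'"
  using assms(2)
proof (induction q w "v1 @ v2" q' arbitrary: v1 rule: run.induct)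
  case (run_Nil q)
  then show ?case by (auto intro: run.run_Nil)
next
  case (run_step q x v r w u q')
  show ?case
  proof (cases "v1 = []")
    case True
    then show ?thesis
      using run.run_step[OF run_step.hyps(1,2)] run_step.hyps(4) run.run_Nil[of \<delta> q]
      by (metis append_Nil)
  next
    case False
    with run_step.hyps(4) letterwise_cases[OF assms(1) run_step.hyps(1)]
    obtain v1' where v1': "v1 = v @ v1'" "u = v1' @ v2"
      by (metis (no_types, lifting) append_Cons append_Nil list.inject neq_Nil_conv)
    from run_step.hyps(3)[OF v1'(2)] obtain s w1 w2 where
      "w = w1 @ w2" "run \<delta> r w1 v1' s" "run \<delta> s w2 v2 q'" by blast
    then show ?thesis
      using run.run_step[OF run_step.hyps(1), of w1 v1' s] v1'(1)
      by (metis append.assoc)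
  qed
qed

definition states :: "('q \<times> 'i list \<times> 'o list \<times> 'q) set \<Rightarrow> 'q set" where
  "states \<delta> = (\<Union>(q, x, v, r)\<in>\<delta>. {q, r})"

lemma finite_states: "finite \<delta> \<Longrightarrow> finite (states \<delta>)"
  unfolding states_def by auto

lemma states_memI: "(q, x, v, r) \<in> \<delta> \<Longrightarrow> q \<in> states \<delta>" "(q, x, v, r) \<in> \<delta> \<Longrightarrow> r \<in> states \<delta>"
  by (force simp: states_def)+

lemma run_states: "run \<delta> q w v r \<Longrightarrow> r \<in> insert q (states \<delta>)"
  by (induction rule: run.induct) (auto dest: states_memI)

text \<open>Every transducer becomes letterwise when its states get a buffer with the output that is still to
  be written.\<close>

definition split_outputs ::
    "('q \<times> 'i list \<times> 'o list \<times> 'q) set \<Rightarrow> (('q \<times> 'o list) \<times> 'i list \<times> 'o list \<times> ('q \<times> 'o list)) set" where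
  "split_outputs \<delta> = (\<lambda>(q, x, v, r). ((q, []), x, [], (r, v))) ` \<delta> \<union>
     (\<Union>(q, x, v, r)\<in>\<delta>. (\<lambda>n. ((r, drop n v), [], [v ! n], (r, drop (Suc n) v))) ` {..<length v})"

lemma finite_split_outputs: "finite \<delta> \<Longrightarrow> finite (split_outputs \<delta>)"
  unfolding split_outputs_def by auto

lemma letterwise_split_outputs: "letterwise (split_outputs \<delta>)"
  unfolding split_outputs_def letterwise_def by auto

lemma run_split_outputs_flush:
  assumes "(q, x, v, r) \<in> \<delta>"
  shows "n \<le> length v \<Longrightarrow> run (split_outputs \<delta>) (r, drop n v) [] (drop n v) (r, [])"
proof (induction "length v - n" arbitrary: n)
  case 0
  then show ?case by (simp add: run_Nil)
next
  case (Suc m)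
  then have n: "n < length v" by simp
  have "((r, drop n v), [], [v ! n], (r, drop (Suc n) v)) \<in> split_outputs \<delta>"
    unfolding split_outputs_def using assms n by fastforce
  from run_step[OF this Suc.hyps(1)[of "Suc n"]] Suc.hyps(2) n show ?case
    by (simp add: Cons_nth_drop_Suc)
qed

lemma run_split_outputsI: "run \<delta> q w v q' \<Longrightarrow> run (split_outputs \<delta>) (q, []) w v (q', [])"
proof (induction rule: run.induct)
  case (run_Nil q)
  show ?case by (rule run.run_Nil)
next
  case (run_step q x v r w u q')
  have first: "((q, []), x, [], (r, v)) \<in> split_outputs \<delta>"
    unfolding split_outputs_def using run_step.hyps(1) by force
  have "run (split_outputs \<delta>) (r, v) [] v (r, [])"
    using run_split_outputs_flush[OF run_step.hyps(1), of 0] by simp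
  then have "run (split_outputs \<delta>) (r, v) w (v @ u) (q', [])"
    using run_append[OF _ run_step.IH] by fastforce
  with first show ?case
    using run.run_step[of "(q, [])" x "[]" "(r, v)" "split_outputs \<delta>" w "v @ u" "(q', [])"] by simp
qed

lemma run_split_outputsD:
  "run (split_outputs \<delta>) s w v s' \<Longrightarrow> snd s' = [] \<Longrightarrow>
    \<exists>u. v = snd s @ u \<and> run \<delta> (fst s) w u (fst s')"
proof (induction rule: run.induct)
  case (run_Nil q)
  then show ?case by (auto intro: run.run_Nil)
next
  case (run_step s x v s1 w u s')
  then obtain u' where u': "u = snd s1 @ u'" "run \<delta> (fst s1) w u' (fst s')" by blast
  from run_step.hyps(1) show ?case
    unfolding split_outputs_def
  proof (elim UnE, goal_cases)
    case 1
    then show ?case using u' by (auto intro: run.run_step)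
  next
    case 2
    then obtain p y ys r' n where *: "(p, y, ys, r') \<in> \<delta>" "n < length ys" "s = (r', drop n ys)"
      "x = []" "v = [ys ! n]" "s1 = (r', drop (Suc n) ys)"
      by auto
    have "v @ u = snd s @ u'"
      using u'(1) * Cons_nth_drop_Suc[OF *(2)] by (metis append_Cons append_Nil snd_conv)
    then show ?case using u'(2) * by auto
  qed
qed

lemma inverse_transduct_split_outputs:
  "inverse_transduct \<delta> q q' L = inverse_transduct (split_outputs \<delta>) (q, []) (q', []) L"
  unfolding inverse_transduct_def
  using run_split_outputsI[of \<delta> q _ _ q'] run_split_outputsD[of \<delta> "(q, [])" _ _ "(q', [])"]
  by fastforce


section \<open>Rational languages are closed under inverse transductions\<close>

lemma rational_UN: "finite I \<Longrightarrow> (\<And>i. i \<in> I \<Longrightarrow> rational (L i)) \<Longrightarrow> rational (\<Union>i\<in>I. L i)"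
  by (induction rule: finite_induct) (auto intro: rational.intros)

lemma rational_finite: "finite L \<Longrightarrow> rational L"
  using rational_UN[of L "\<lambda>w. {w}"] by (simp add: rational_single)

text \<open>Words labelling a path from \<open>q\<close> to \<open>q'\<close> whose intermediate states lie in \<open>S\<close>, where a step
  from \<open>q\<close> to \<open>r\<close> may read any word of \<open>M q r\<close>.\<close>

inductive path :: "('q \<Rightarrow> 'q \<Rightarrow> 'l list set) \<Rightarrow> 'q set \<Rightarrow> 'q \<Rightarrow> 'l list \<Rightarrow> 'q \<Rightarrow> bool"
  for M S where
  path_single: "x \<in> M q r \<Longrightarrow> path M S q x r"
| path_step: "x \<in> M q r \<Longrightarrow> r \<in> S \<Longrightarrow> path M S r w q' \<Longrightarrow> path M S q (x @ w) q'"

lemma path_append: "path M S q w r \<Longrightarrow> r \<in> S \<Longrightarrow> path M S r w' q' \<Longrightarrow> path M S q (w @ w') q'"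
  by (induction rule: path.induct) (auto intro: path.intros)

lemma path_mono: "path M S q w r \<Longrightarrow> S \<subseteq> S' \<Longrightarrow> path M S' q w r"
  by (induction rule: path.induct) (auto intro: path.intros)

lemma path_insertD:
  "path M (insert s S) q w q' \<Longrightarrow> path M S q w q' \<or>
    (\<exists>u ws v. w = u @ concat ws @ v \<and> path M S q u s \<and> (\<forall>x\<in>set ws. path M S s x s) \<and> path M S s v q')"
proof (induction rule: path.induct)
  case (path_single x q r)
  then show ?case by (auto intro: path.intros)
next
  case (path_step x q r w q')
  show ?case
  proof (cases "r = s")
    case True
    from path_step.IH show ?thesis
    proof
      assume "path M S r w q'"
      then show ?thesis
        using True path_step.hyps(1)
        by (intro disjI2 exI[of _ x] exI[of _ "[]"] exI[of _ w]) (auto intro: path.intros)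
    next
      assume "\<exists>u ws v. w = u @ concat ws @ v \<and> path M S r u s \<and>
        (\<forall>x\<in>set ws. path M S s x s) \<and> path M S s v q'"
      then obtain u ws v where "w = u @ concat ws @ v" "path M S r u s"
        "\<forall>x\<in>set ws. path M S s x s" "path M S s v q'" by blast
      then show ?thesis
        using True path_step.hyps(1)
        by (intro disjI2 exI[of _ x] exI[of _ "u # ws"] exI[of _ v]) (auto intro: path.intros)
    qed
  next
    case False
    with path_step.hyps(2) have "r \<in> S" by simp
    from path_step.IH show ?thesis
    proof
      assume "path M S r w q'"
      then show ?thesis using path_step.hyps(1) \<open>r \<in> S\<close> by (auto intro: path.intros)
    next
      assume "\<exists>u ws v. w = u @ concat ws @ v \<and> path M S r u s \<and>
        (\<forall>x\<in>set ws. path M S s x s) \<and> path M S s v q'"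
      then obtain u ws v where "w = u @ concat ws @ v" "path M S r u s"
        "\<forall>x\<in>set ws. path M S s x s" "path M S s v q'" by blast
      then show ?thesis
        using path.path_step[of x M q r S u s] path_step.hyps(1) \<open>r \<in> S\<close>
        by (intro disjI2 exI[of _ "x @ u"] exI[of _ ws] exI[of _ v]) auto
    qed
  qed
qed

lemma path_loops:
  "\<forall>x\<in>set ws. path M S s x s \<Longrightarrow> path M S s v q' \<Longrightarrow> path M (insert s S) s (concat ws @ v) q'"
proof (induction ws)
  case Nil
  then show ?case by (auto intro: path_mono)
next
  case (Cons w ws)
  then show ?case
    using path_append[of M "insert s S" s w s "concat ws @ v" q'] path_mono[of M S s w s "insert s S"]
    by auto
qed

text \<open>Kleene's argument: admit the intermediate states one at a time.\<close>

lemma rational_path: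
  assumes "finite S" "\<And>q r. rational (M q r)"
  shows "rational {w. path M S q w q'}"
  using assms(1)
proof (induction arbitrary: q q' rule: finite_induct)
  case empty
  have "{w. path M {} q w q'} = M q q'"
    by (auto elim: path.cases intro: path.intros)
  then show ?case using assms(2) by simp
next
  case (insert s S)
  let ?P = "\<lambda>q q'. {w. path M S q w q'}"
  let ?star = "{concat ws | ws. ws \<in> lists (?P s s)}"
  have "{w. path M (insert s S) q w q'} =
      ?P q q' \<union> {u @ v | u v. u \<in> ?P q s \<and> v \<in> {u @ v | u v. u \<in> ?star \<and> v \<in> ?P s q'}}"
    (is "?L = ?R")
  proof
    show "?L \<subseteq> ?R"
    proof
      fix w assume "w \<in> ?L"
      then consider "path M S q w q'" | u ws v where "w = u @ concat ws @ v" "path M S q u s"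
        "\<forall>x\<in>set ws. path M S s x s" "path M S s v q'"
        by (auto dest: path_insertD)
      then show "w \<in> ?R"
      proof cases
        case 1
        then show ?thesis by simp
      next
        case 2
        then have "concat ws \<in> ?star" by (auto simp: lists_eq_set)
        with 2 show ?thesis by blast
      qed
    qed
    show "?R \<subseteq> ?L"
    proof
      fix w assume "w \<in> ?R"
      then consider "path M S q w q'" | u ws v where "w = u @ concat ws @ v" "path M S q u s"
        "\<forall>x\<in>set ws. path M S s x s" "path M S s v q'"
        by (auto simp: lists_eq_set subset_iff)
      then show "w \<in> ?L"
      proof cases
        case 1
        then show ?thesis by (auto intro: path_mono)
      next
        case 2
        then show ?thesis
          using path_append[OF path_mono[of M S q u s "insert s S"] _ path_loops[of ws M S s v q']]
          by (simp add: subset_insertI)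
      qed
    qed
  qed
  moreover have "rational ?R"
    by (intro rational.intros insert.IH)
  ultimately show ?case by simp
qed

lemma rational_inverse_transduct_Nil:
  fixes \<delta> :: "('q \<times> 'i list \<times> 'o list \<times> 'q) set"
  assumes "finite \<delta>"
  shows "rational (inverse_transduct \<delta> q q' {[]})"
proof -
  define M where "M q r = {x. (q, x, [] :: 'o list, r) \<in> \<delta>}" for q r
  have fin: "finite (M q r)" for q r
  proof (rule finite_subset)
    show "M q r \<subseteq> (\<lambda>(q, x, v, r). x) ` \<delta>" unfolding M_def by force
  qed (use assms in simp)
  have 1: "run \<delta> q w v q' \<Longrightarrow> v = [] \<Longrightarrow> (q = q' \<and> w = []) \<or> path M (states \<delta>) q w q'" for q w v q'
  proof (induction rule: run.induct)
    case (run_step q x v r w u q')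
    then show ?case
      by (auto simp: M_def intro: path.intros dest: states_memI)
  qed simp
  have 2: "path M (states \<delta>) q w q' \<Longrightarrow> run \<delta> q w [] q'" for q w q'
  proof (induction rule: path.induct)
    case (path_single x q r)
    then show ?case by (simp add: M_def run_single)
  next
    case (path_step x q r w q')
    then show ?case using run_step[of q x "[]" r \<delta> w "[]" q'] by (simp add: M_def)
  qed
  have "inverse_transduct \<delta> q q' {[]} = {w. path M (states \<delta>) q w q'} \<union> (if q = q' then {[]} else {})"
    unfolding inverse_transduct_def using 1 2 by (auto intro: run_Nil)
  moreover have "rational {w. path M (states \<delta>) q w q'}"
    using assms fin by (intro rational_path finite_states rational_finite)
  ultimately show ?thesis
    by (simp only:) (intro rational_union, auto intro: rational.intros)
qed

lemma inverse_transduct_concat: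
  assumes "letterwise \<delta>"
  shows "inverse_transduct \<delta> q q' {u @ v | u v. u \<in> L \<and> v \<in> M} =
    (\<Union>r\<in>insert q (states \<delta>).
       {u @ v | u v. u \<in> inverse_transduct \<delta> q r L \<and> v \<in> inverse_transduct \<delta> r q' M})"
    (is "?L = ?R")
proof
  show "?L \<subseteq> ?R"
  proof
    fix w assume "w \<in> ?L"
    then obtain u v where uv: "u \<in> L" "v \<in> M" "run \<delta> q w (u @ v) q'"
      by (auto simp: inverse_transduct_def)
    from run_split[OF assms uv(3)] obtain r w1 w2 where
      r: "w = w1 @ w2" "run \<delta> q w1 u r" "run \<delta> r w2 v q'" by blast
    then show "w \<in> ?R"
      using uv run_states[OF r(2)] unfolding inverse_transduct_def by blast
  qed
  show "?R \<subseteq> ?L"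
    by (auto simp: inverse_transduct_def) (blast intro: run_append)+
qed

lemma run_letterD:
  assumes "letterwise \<delta>" "run \<delta> q w [a] q'"
  shows "\<exists>w1 x w2 r r'. w = w1 @ x @ w2 \<and> run \<delta> q w1 [] r \<and> (r, x, [a], r') \<in> \<delta> \<and> run \<delta> r' w2 [] q'"
  using assms(2)
proof (induction q w "[a]" q' rule: run.induct)
  case (run_step q x v r w u q')
  from letterwise_cases[OF assms(1) run_step.hyps(1)] show ?case
  proof cases
    case 1
    with run_step.hyps(3,4) obtain w1 x' w2 s s' where
      *: "w = w1 @ x' @ w2" "run \<delta> r w1 [] s" "(s, x', [a], s') \<in> \<delta>" "run \<delta> s' w2 [] q'"
      by auto
    have "run \<delta> q (x @ w1) [] s"
      using run.run_step[OF run_step.hyps(1) *(2)] 1 by simp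
    then show ?thesis
      using * by (intro exI[of _ "x @ w1"] exI[of _ x'] exI[of _ w2]) auto
  next
    case (2 b)
    then have "v = [a]" "u = []" using run_step.hyps(4) by auto
    then show ?thesis
      using run_step.hyps(1,2) run.run_Nil[of \<delta> q]
      by (intro exI[of _ "[]"] exI[of _ x] exI[of _ w] exI[of _ q] exI[of _ r]) simp
  qed
qed

lemma rational_inverse_transduct_letter:
  assumes "finite \<delta>" "letterwise \<delta>"
  shows "rational (inverse_transduct \<delta> q q' {[a]})"
proof -
  define J where "J = {e \<in> \<delta>. fst (snd (snd e)) = [a]}"
  let ?N = "\<lambda>q q'. inverse_transduct \<delta> q q' {[]}"
  have "inverse_transduct \<delta> q q' {[a]} = (\<Union>(r, x, v, r')\<in>J.
      {u @ w | u w. u \<in> ?N q r \<and> w \<in> {x @ w | x' w. x' \<in> {x} \<and> w \<in> ?N r' q'}})" (is "?L = ?R")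
  proof
    show "?L \<subseteq> ?R"
      by (auto simp: inverse_transduct_def J_def dest!: run_letterD[OF assms(2)]) force
    show "?R \<subseteq> ?L"
    proof (clarsimp simp: inverse_transduct_def J_def)
      fix r x r' u w assume *: "(r, x, [a], r') \<in> \<delta>" "run \<delta> q u [] r" "run \<delta> r' w [] q'"
      show "run \<delta> q (u @ x @ w) [a] q'"
        using run_append[OF *(2) run_step[OF *(1,3)]] by simp
    qed
  qed
  moreover have "rational ?R"
  proof (intro rational_UN)
    show "finite J" using assms(1) by (simp add: J_def)
    fix e assume "e \<in> J"
    obtain r x v r' where e: "e = (r, x, v, r')" by (metis prod_cases4)
    have "rational {x @ w | x' w. x' \<in> {x} \<and> w \<in> ?N r' q'}"
      using rational_concat[OF rational_single[of x] rational_inverse_transduct_Nil[OF assms(1), of r' q']]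
      by simp
    then show "rational (case e of (r, x, v, r') \<Rightarrow>
        {u @ w | u w. u \<in> ?N q r \<and> w \<in> {x @ w | x' w. x' \<in> {x} \<and> w \<in> ?N r' q'}})"
      unfolding e by (simp only: prod.case) (intro rational_concat rational_inverse_transduct_Nil assms(1))
  qed
  ultimately show ?thesis by simp
qed

lemma rational_inverse_transduct_concat:
  assumes "finite \<delta>" "letterwise \<delta>"
    and "\<And>q q'. rational (inverse_transduct \<delta> q q' L)" "\<And>q q'. rational (inverse_transduct \<delta> q q' M)"
  shows "rational (inverse_transduct \<delta> q q' {u @ v | u v. u \<in> L \<and> v \<in> M})"
  unfolding inverse_transduct_concat[OF assms(2)]
  using assms by (intro rational_UN rational_concat) (simp_all add: finite_states)

text \<open>By induction on the rational expression. For an iteration \<open>L\<^sup>*\<close>, a run cut at the boundaries of the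
  factors is a path whose steps are labelled by the languages already known to be rational for \<open>L\<close>.\<close>

lemma rational_inverse_transduct_letterwise:
  assumes "rational L" "finite \<delta>" "letterwise \<delta>"
  shows "rational (inverse_transduct \<delta> q q' L)"
  using assms(1)
proof (induction arbitrary: q q' rule: rational.induct)
  case rational_empty
  then show ?case by (simp add: inverse_transduct_def rational.rational_empty)
next
  case (rational_single w)
  show ?case
  proof (induction w arbitrary: q q')
    case Nil
    show ?case by (rule rational_inverse_transduct_Nil[OF assms(2)])
  next
    case (Cons a w)
    have "{a # w} = {u @ v | u v. u \<in> {[a]} \<and> v \<in> {w}}" by auto
    then show ?case
      using rational_inverse_transduct_concat[OF assms(2,3) rational_inverse_transduct_letter[OF assms(2,3)] Cons.IH]
      by (simp only:)
  qed
next
  case (rational_union L M)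
  have "inverse_transduct \<delta> q q' (L \<union> M) = inverse_transduct \<delta> q q' L \<union> inverse_transduct \<delta> q q' M"
    by (auto simp: inverse_transduct_def)
  then show ?case using rational_union.IH by (simp add: rational.rational_union)
next
  case (rational_concat L M)
  show ?case by (rule rational_inverse_transduct_concat[OF assms(2,3) rational_concat.IH])
next
  case (rational_star L)
  let ?M = "\<lambda>q q'. inverse_transduct \<delta> q q' L"
  let ?S = "insert q (states \<delta>)"
  have 1: "path ?M ?S r w q' \<or> (vs = [] \<and> run \<delta> r w [] q')"
    if "run \<delta> r w (concat vs) q'" "set vs \<subseteq> L" "r \<in> ?S" for r w vs
    using that
  proof (induction vs arbitrary: r w)
    case (Cons v vs)
    from run_split[OF assms(3), of r w v "concat vs" q'] Cons.prems(1)
    obtain s w1 w2 where s: "w = w1 @ w2" "run \<delta> r w1 v s" "run \<delta> s w2 (concat vs) q'" by auto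
    have m: "w1 \<in> ?M r s" using s(2) Cons.prems(2) by (auto simp: inverse_transduct_def)
    have sS: "s \<in> ?S" using run_states[OF s(2)] Cons.prems(3) by auto
    show ?case
    proof (cases "vs = []")
      case True
      then have "run \<delta> r w v q'" using run_append[OF s(2), of w2 "[]" q'] s(1,3) by simp
      then have "w \<in> ?M r q'" using Cons.prems(2) by (auto simp: inverse_transduct_def)
      then show ?thesis by (auto intro: path_single)
    next
      case False
      then have "path ?M ?S s w2 q'" using Cons.IH[OF s(3) _ sS] Cons.prems(2) by auto
      then show ?thesis using path_step[of w1 ?M r s ?S w2 q'] m sS s(1) by blast
    qed
  qed simp
  have 2: "\<exists>vs. set vs \<subseteq> L \<and> run \<delta> r w (concat vs) q'" if "path ?M ?S r w q'" for r w q'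
    using that
  proof (induction rule: path.induct)
    case (path_single x q r)
    then obtain v where "v \<in> L" "run \<delta> q x v r" by (auto simp: inverse_transduct_def)
    then show ?case by (intro exI[of _ "[v]"]) simp
  next
    case (path_step x q r w q')
    then obtain v vs where "v \<in> L" "run \<delta> q x v r" "set vs \<subseteq> L" "run \<delta> r w (concat vs) q'"
      by (auto simp: inverse_transduct_def)
    then show ?case by (intro exI[of _ "v # vs"]) (simp add: run_append)
  qed
  have "inverse_transduct \<delta> q q' {concat ws | ws. ws \<in> lists L} =
      {w. path ?M ?S q w q'} \<union> inverse_transduct \<delta> q q' {[]}" (is "?L = ?R")
  proof
    show "?L \<subseteq> ?R" using 1[of q] by (fastforce simp: inverse_transduct_def lists_eq_set)
    show "?R \<subseteq> ?L"
    proof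
      fix w assume "w \<in> ?R"
      then have "\<exists>vs. set vs \<subseteq> L \<and> run \<delta> q w (concat vs) q'"
        using 2[of q w q'] by (auto simp: inverse_transduct_def intro: exI[of _ "[]"])
      then show "w \<in> ?L" by (auto simp: inverse_transduct_def lists_eq_set)
    qed
  qed
  moreover have "rational {w. path ?M ?S q w q'}"
    using rational_star.IH assms(2) by (intro rational_path) (simp_all add: finite_states)
  ultimately show ?case
    by (simp add: rational.rational_union rational_inverse_transduct_Nil[OF assms(2)])
qed

theorem rational_inverse_transduct:
  assumes "rational L" "finite \<delta>"
  shows "rational (inverse_transduct \<delta> q q' L)"
  unfolding inverse_transduct_split_outputs[of \<delta>]
  using assms(1) finite_split_outputs[OF assms(2)] letterwise_split_outputs
  by (rule rational_inverse_transduct_letterwise)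


section \<open>Context-free languages are closed under inverse transductions\<close>

text \<open>A big-step form of derivability, which follows the shape of the sentential form and so lends
  itself to induction. The nonterminals may have any type, since the construction below uses triples.\<close>

inductive yields :: "('n \<times> ('n + 'l) list) set \<Rightarrow> ('n + 'l) list \<Rightarrow> 'l list \<Rightarrow> bool" for P where
  yields_Nil: "yields P [] []"
| yields_terminal: "yields P \<alpha> w \<Longrightarrow> yields P (Inr a # \<alpha>) (a # w)"
| yields_nonterminal: "(N, \<rho>) \<in> P \<Longrightarrow> yields P \<rho> u \<Longrightarrow> yields P \<alpha> w \<Longrightarrow> yields P (Inl N # \<alpha>) (u @ w)"

lemma yields_append: "yields P \<alpha> u \<Longrightarrow> yields P \<beta> v \<Longrightarrow> yields P (\<alpha> @ \<beta>) (u @ v)"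
  by (induction rule: yields.induct) (simp_all add: yields_terminal yields_nonterminal)

lemma yields_appendD: "yields P (\<alpha> @ \<beta>) w \<Longrightarrow> \<exists>u v. w = u @ v \<and> yields P \<alpha> u \<and> yields P \<beta> v"
proof (induction "\<alpha> @ \<beta>" w arbitrary: \<alpha> rule: yields.induct)
  case yields_Nil
  then show ?case by (auto intro: yields.intros)
next
  case (yields_terminal \<gamma> w a)
  show ?case
  proof (cases \<alpha>)
    case Nil
    then show ?thesis
      using yields.yields_terminal[OF yields_terminal.hyps(1), of a] yields_terminal.hyps(3) yields.yields_Nil[of P]
      by (metis append_Nil)
  next
    case (Cons X \<alpha>')
    with yields_terminal.hyps(3) have "\<gamma> = \<alpha>' @ \<beta>" "X = Inr a" by auto
    with yields_terminal.hyps(2) Cons show ?thesis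
      by (metis append_Cons yields.yields_terminal)
  qed
next
  case (yields_nonterminal N \<rho> u \<gamma> w)
  show ?case
  proof (cases \<alpha>)
    case Nil
    then show ?thesis
      using yields.yields_nonterminal[OF yields_nonterminal.hyps(1,2,4)] yields_nonterminal.hyps(6)
        yields.yields_Nil[of P]
      by (metis append_Nil)
  next
    case (Cons X \<alpha>')
    with yields_nonterminal.hyps(6) have "\<gamma> = \<alpha>' @ \<beta>" "X = Inl N" by auto
    with yields_nonterminal.hyps(1,2,5) Cons show ?thesis
      by (metis append.assoc yields.yields_nonterminal)
  qed
qed

lemma yields_production: "(N, \<rho>) \<in> P \<Longrightarrow> yields P \<rho> u \<Longrightarrow> yields P [Inl N] u"
  using yields_nonterminal[OF _ _ yields_Nil, of N \<rho> P u] by simp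

lemma yields_word: "yields P (map Inr w) w"
  by (induction w) (simp_all add: yields_Nil yields_terminal)

lemma derives_trans: "derives P s r \<Longrightarrow> derives P r r' \<Longrightarrow> derives P s r'"
  by (rotate_tac 1, induction rule: derives.induct) (blast intro: derives_step)+

lemma derives_context: "derives P s r \<Longrightarrow> derives P (x @ s @ y) (x @ r @ y)"
proof (induction rule: derives.induct)
  case (derives_refl s)
  show ?case by (rule derives.derives_refl)
next
  case (derives_step s u N v r)
  then show ?case using derives.derives_step[of P "x @ s @ y" "x @ u" N "v @ y" r] by simp
qed

lemma yields_imp_derives: "yields P \<alpha> w \<Longrightarrow> derives P \<alpha> (map Inr w)"
proof (induction rule: yields.induct)
  case yields_Nil
  show ?case by (simp add: derives_refl)
next
  case (yields_terminal \<alpha> w a)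
  then show ?case using derives_context[of P \<alpha> "map Inr w" "[Inr a]" "[]"] by simp
next
  case (yields_nonterminal N \<rho> u \<alpha> w)
  have "derives P (Inl N # \<alpha>) (\<rho> @ \<alpha>)"
    using derives_step[of P "[Inl N] @ \<alpha>" "[]" N \<alpha> \<rho>] yields_nonterminal.hyps(1)
    by (simp add: derives_refl)
  moreover have "derives P (\<rho> @ \<alpha>) (map Inr u @ \<alpha>)"
    using derives_context[OF yields_nonterminal.IH(1), of "[]" \<alpha>] by simp
  moreover have "derives P (map Inr u @ \<alpha>) (map Inr u @ map Inr w)"
    using derives_context[OF yields_nonterminal.IH(2), of "map Inr u" "[]"] by simp
  ultimately show ?case by (metis derives_trans map_append)
qed

lemma derives_imp_yields: "derives P s r \<Longrightarrow> yields P r w \<Longrightarrow> yields P s w"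
proof (induction arbitrary: w rule: derives.induct)
  case (derives_step s u N v r)
  from yields_appendD[OF derives_step.prems] obtain w1 w' where
    w': "w = w1 @ w'" "yields P u w1" "yields P (r @ v) w'" by (elim exE conjE) (rule that)
  from yields_appendD[OF w'(3)] obtain w2 w3 where
    "w' = w2 @ w3" "yields P r w2" "yields P v w3" by (elim exE conjE) (rule that)
  with w' have w: "w = w1 @ w2 @ w3" "yields P u w1" "yields P r w2" "yields P v w3" by simp_all
  have "yields P (u @ [Inl N] @ v) (w1 @ w2 @ w3)"
    by (intro yields_append w yields_production[OF derives_step.hyps(2)])
  then show ?case using derives_step.IH w(1) by simp
qed

lemma derives_iff_yields: "derives P s (map Inr w) \<longleftrightarrow> yields P s w"
  using derives_imp_yields[OF _ yields_word] yields_imp_derives by blast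

definition rename_production :: "('n \<Rightarrow> 'm) \<Rightarrow> 'n \<times> ('n + 'l) list \<Rightarrow> 'm \<times> ('m + 'l) list" where
  "rename_production f = map_prod f (map (map_sum f id))"

lemma yields_rename:
  "yields P \<alpha> w \<Longrightarrow> yields (rename_production f ` P) (map (map_sum f id) \<alpha>) w"
proof (induction rule: yields.induct)
  case (yields_nonterminal N \<rho> u \<alpha> w)
  have "(f N, map (map_sum f id) \<rho>) \<in> rename_production f ` P"
    using yields_nonterminal.hyps(1) by (force simp: rename_production_def)
  then show ?case using yields_nonterminal.IH by (simp add: yields.yields_nonterminal id_def)
qed (simp_all add: yields_Nil yields_terminal)

text \<open>Only finitely many nonterminals occur in a finite grammar, so their type is immaterial.\<close>

lemma context_free_grammar:
  fixes P :: "('n \<times> ('n + 'l) list) set"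
  assumes "finite P"
  shows "context_free {w. yields P [Inl S] w}"
proof -
  define U where "U = insert S (fst ` P \<union> (\<Union>(N, \<rho>)\<in>P. {M. Inl M \<in> set \<rho>}))"
  have "finite {M. Inl M \<in> set \<rho>}" for \<rho> :: "('n + 'l) list"
    using finite_vimageI[of "set \<rho>" Inl] by (simp add: vimage_def)
  then have "finite U" unfolding U_def using assms by auto
  then obtain f :: "'n \<Rightarrow> nat" where f: "inj_on f U"
    using finite_imp_inj_to_nat_seg[of U] by blast
  define g where "g = inv_into U f"
  have gf: "g (f N) = N" if "N \<in> U" for N
    using that f by (simp add: g_def)
  have restore: "rename_production g (rename_production f e) = e" if e: "e \<in> P" for e
  proof -
    obtain N \<rho> where [simp]: "e = (N, \<rho>)" by force
    have "map (map_sum g id) (map (map_sum f id) \<rho>) = \<rho>"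
      unfolding map_map
    proof (rule map_idI)
      fix X assume X: "X \<in> set \<rho>"
      show "(map_sum g id \<circ> map_sum f id) X = X"
      proof (cases X)
        case (Inl M)
        then have "M \<in> U" using X e by (auto simp: U_def)
        then show ?thesis using Inl gf by simp
      qed simp
    qed
    moreover have "N \<in> U" using e by (force simp: U_def)
    ultimately show ?thesis by (simp add: rename_production_def gf)
  qed
  have P: "rename_production g ` rename_production f ` P = P"
    unfolding image_image using image_cong[OF refl restore, of P] by simp
  have "yields (rename_production f ` P) [Inl (f S)] w \<longleftrightarrow> yields P [Inl S] w" for w
  proof
    assume "yields P [Inl S] w"
    from yields_rename[OF this, of f] show "yields (rename_production f ` P) [Inl (f S)] w" by simp
  next
    assume "yields (rename_production f ` P) [Inl (f S)] w"
    from yields_rename[OF this, of g] show "yields P [Inl S] w"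
      by (simp add: P gf[of S] U_def)
  qed
  then have "{w. yields P [Inl S] w} = {w. derives (rename_production f ` P) [Inl (f S)] (map Inr w)}"
    by (simp add: derives_iff_yields)
  then show ?thesis
    unfolding context_free_def using assms by blast
qed

text \<open>The triple construction of Bar-Hillel, Perles and Shamir: the nonterminal
  \<open>(q, X, r)\<close> stands for the words that are read along a run from \<open>q\<close> to \<open>r\<close> whose output is derived from the symbol \<open>X\<close>.\<close>

fun annotate :: "'q set \<Rightarrow> 'q \<Rightarrow> 'y list \<Rightarrow> 'q \<Rightarrow> (('q \<times> 'y \<times> 'q) + 'i) list set" where
  "annotate Q q [] q' = (if q = q' then {[]} else {})"
| "annotate Q q (X # \<alpha>) q' = (\<Union>r\<in>Q. (\<lambda>\<beta>. Inl (q, X, r) # \<beta>) ` annotate Q r \<alpha> q')"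

lemma finite_annotate: "finite Q \<Longrightarrow> finite (annotate Q q \<alpha> q')"
  by (induction \<alpha> arbitrary: q) auto

text \<open>Besides the annotated productions of the grammar, a triple \<open>(q, a, r)\<close> for a terminal \<open>a\<close>
  produces what a transition that writes \<open>a\<close> reads, and transitions that write nothing may be
  attached to either end of any triple.\<close>

definition triple_productions ::
    "('q \<times> 'i list \<times> 'o list \<times> 'q) set \<Rightarrow> 'q set \<Rightarrow> ('n + 'o) set \<Rightarrow> ('n \<times> ('n + 'o) list) set \<Rightarrow>
     (('q \<times> ('n + 'o) \<times> 'q) \<times> (('q \<times> ('n + 'o) \<times> 'q) + 'i) list) set" where
  "triple_productions \<delta> Q Y P =
     (\<Union>(N, \<rho>)\<in>P. \<Union>q\<in>Q. \<Union>q'\<in>Q. (\<lambda>\<beta>. ((q, Inl N, q'), \<beta>)) ` annotate Q q \<rho> q') \<union>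
     (\<Union>(q, x, v, r)\<in>\<delta>. (\<lambda>a. ((q, Inr a, r), map Inr x)) ` {a. v = [a]}) \<union>
     (\<Union>(q, x, v, r)\<in>{e \<in> \<delta>. fst (snd (snd e)) = []}. \<Union>X\<in>Y. \<Union>s\<in>Q.
        {((q, X, s), map Inr x @ [Inl (r, X, s)]), ((s, X, r), Inl (s, X, q) # map Inr x)})"

lemma finite_triple_productions:
  assumes "finite \<delta>" "finite Q" "finite Y" "finite P"
  shows "finite (triple_productions \<delta> Q Y P)"
proof -
  have "finite {a. v = [a]}" for v :: "'o list"
    by (rule finite_subset[of _ "set v"]) auto
  then show ?thesis
    unfolding triple_productions_def using assms
    by (intro finite_UnI finite_UN_I; auto simp: finite_annotate)
qed

text \<open>The invariant of the soundness proof: a triple may only be replaced by input whose translation its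
  symbol derives.\<close>

fun realizes ::
    "('q \<times> 'i list \<times> 'o list \<times> 'q) set \<Rightarrow> ('n \<times> ('n + 'o) list) set \<Rightarrow>
     (('q \<times> ('n + 'o) \<times> 'q) + 'i) list \<Rightarrow> 'i list \<Rightarrow> bool" where
  "realizes \<delta> P [] w \<longleftrightarrow> w = []"
| "realizes \<delta> P (Inr x # \<beta>) w \<longleftrightarrow> (\<exists>u. w = x # u \<and> realizes \<delta> P \<beta> u)"
| "realizes \<delta> P (Inl (q, X, r) # \<beta>) w \<longleftrightarrow>
     (\<exists>u w' v. w = u @ w' \<and> yields P [X] v \<and> run \<delta> q u v r \<and> realizes \<delta> P \<beta> w')"

lemma realizes_word: "realizes \<delta> P (map Inr x @ \<beta>) w \<longleftrightarrow> (\<exists>u. w = x @ u \<and> realizes \<delta> P \<beta> u)"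
  by (induction x arbitrary: w) auto

lemma realizes_annotate:
  "\<beta> \<in> annotate Q q \<alpha> q' \<Longrightarrow> realizes \<delta> P \<beta> w \<Longrightarrow> \<exists>v. yields P \<alpha> v \<and> run \<delta> q w v q'"
proof (induction \<alpha> arbitrary: q \<beta> w)
  case Nil
  then show ?case by (auto split: if_splits intro: yields_Nil run_Nil)
next
  case (Cons X \<alpha>)
  then obtain r \<beta>' where r: "\<beta> = Inl (q, X, r) # \<beta>'" "\<beta>' \<in> annotate Q r \<alpha> q'" by auto
  with Cons.prems(2) obtain u w' v where
    *: "w = u @ w'" "yields P [X] v" "run \<delta> q u v r" "realizes \<delta> P \<beta>' w'" by auto
  from Cons.IH[OF r(2) *(4)] obtain v' where "yields P \<alpha> v'" "run \<delta> r w' v' q'" by blast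
  then show ?case
    using * yields_append[OF *(2), of \<alpha> v'] run_append[OF *(3)] by auto
qed

lemma yields_triple_sound: "yields (triple_productions \<delta> Q Y P) \<beta> w \<Longrightarrow> realizes \<delta> P \<beta> w"
proof (induction rule: yields.induct)
  case (yields_nonterminal M \<rho> u \<alpha> w)
  obtain q X q' where M: "M = (q, X, q')" by (metis prod_cases3)
  from yields_nonterminal.hyps(1) have "\<exists>v. yields P [X] v \<and> run \<delta> q u v q'"
    unfolding triple_productions_def M
  proof (elim UnE, goal_cases)
    case 1
    then obtain N \<sigma> where "(N, \<sigma>) \<in> P" "X = Inl N" and \<sigma>: "\<rho> \<in> annotate Q q \<sigma> q'" by auto
    from realizes_annotate[OF \<sigma> yields_nonterminal.IH(1)]
    obtain v where v: "yields P \<sigma> v" "run \<delta> q u v q'" by (elim exE conjE) (rule that)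
    show ?case
      using yields_production[OF \<open>(N, \<sigma>) \<in> P\<close> v(1)] v(2) \<open>X = Inl N\<close> by (intro exI conjI) simp_all
  next
    case 2
    then obtain x a where *: "(q, x, [a], q') \<in> \<delta>" "X = Inr a" "\<rho> = map Inr x" by auto
    then have "u = x" using yields_nonterminal.IH(1) realizes_word[of \<delta> P x "[]" u] by simp
    then show ?case using * run_single[OF *(1)] yields_word[of P "[a]"] by auto
  next
    case 3
    then consider x r where "(q, x, [], r) \<in> \<delta>" "\<rho> = map Inr x @ [Inl (r, X, q')]"
      | x r where "(r, x, [], q') \<in> \<delta>" "\<rho> = Inl (q, X, r) # map Inr x"
      by auto
    then show ?case
    proof cases
      case 1
      then obtain u' v where "u = x @ u'" "yields P [X] v" "run \<delta> r u' v q'"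
        using yields_nonterminal.IH(1) by (auto simp: realizes_word)
      then show ?thesis using run_step[OF 1(1), of u' v q'] by auto
    next
      case 2
      then obtain u' v where *: "u = u' @ x" "yields P [X] v" "run \<delta> q u' v r"
        using yields_nonterminal.IH(1) realizes_word[of \<delta> P x "[]"] by auto
      then show ?thesis using run_append[OF *(3) run_single[OF 2(1)]] by auto
    qed
  qed
  with yields_nonterminal.IH(2) show ?case unfolding M by auto
qed auto

context
  fixes \<delta> :: "('q \<times> 'i list \<times> 'o list \<times> 'q) set" and Q :: "'q set" and Y :: "('n + 'o) set"
    and P :: "('n \<times> ('n + 'o) list) set"
  assumes letterwise: "letterwise \<delta>" and states_subset: "states \<delta> \<subseteq> Q"
begin

abbreviation "triple_grammar \<equiv> triple_productions \<delta> Q Y P"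

lemma run_in_states: "run \<delta> q w v r \<Longrightarrow> q \<in> Q \<Longrightarrow> r \<in> Q"
  using run_states states_subset by fastforce

lemma yields_triple_silent_left:
  "run \<delta> q w v r \<Longrightarrow> v = [] \<Longrightarrow> X \<in> Y \<Longrightarrow> s \<in> Q \<Longrightarrow> yields triple_grammar [Inl (r, X, s)] u \<Longrightarrow>
    yields triple_grammar [Inl (q, X, s)] (w @ u)"
proof (induction rule: run.induct)
  case (run_step q x v r w v' r')
  then have "yields triple_grammar (map Inr x @ [Inl (r, X, s)]) (x @ w @ u)"
    by (intro yields_append yields_word) auto
  moreover have "((q, X, s), map Inr x @ [Inl (r, X, s)]) \<in> triple_grammar"
    unfolding triple_productions_def using run_step.hyps(1) run_step.prems by fastforce
  ultimately show ?case by (auto intro: yields_production)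
qed simp

lemma yields_triple_silent_right:
  "run \<delta> q w v r \<Longrightarrow> v = [] \<Longrightarrow> X \<in> Y \<Longrightarrow> s \<in> Q \<Longrightarrow> yields triple_grammar [Inl (s, X, q)] u \<Longrightarrow>
    yields triple_grammar [Inl (s, X, r)] (u @ w)"
proof (induction arbitrary: u rule: run.induct)
  case (run_step q x v r w v' r')
  then have "yields triple_grammar ([Inl (s, X, q)] @ map Inr x) (u @ x)"
    by (intro yields_append yields_word) auto
  moreover have "((s, X, r), Inl (s, X, q) # map Inr x) \<in> triple_grammar"
    unfolding triple_productions_def using run_step.hyps(1) run_step.prems by fastforce
  ultimately have "yields triple_grammar [Inl (s, X, r)] (u @ x)" by (auto intro: yields_production)
  with run_step.IH[of "u @ x"] run_step.prems show ?case by simp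
qed simp

lemma yields_triple_terminal:
  assumes "run \<delta> q w [a] r" "Inr a \<in> Y" "q \<in> Q"
  shows "yields triple_grammar [Inl (q, Inr a, r)] w"
proof -
  from run_letterD[OF letterwise assms(1)] obtain w1 x w2 s s' where
    *: "w = w1 @ x @ w2" "run \<delta> q w1 [] s" "(s, x, [a], s') \<in> \<delta>" "run \<delta> s' w2 [] r" by blast
  have "((s, Inr a, s'), map Inr x) \<in> triple_grammar"
    unfolding triple_productions_def using *(3) by force
  then have "yields triple_grammar [Inl (s, Inr a, s')] x"
    by (rule yields_production) (rule yields_word)
  then have "yields triple_grammar [Inl (s, Inr a, r)] (x @ w2)"
    using run_in_states[OF *(2) assms(3)] by (intro yields_triple_silent_right[OF *(4) _ assms(2)]) auto
  then show ?thesis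
    unfolding *(1) using run_in_states[OF assms(1,3)]
    by (intro yields_triple_silent_left[OF *(2) _ assms(2)]) auto
qed

text \<open>An initial part of the run that writes nothing is split off because the empty sentential form has
  no triple that could absorb it. At the start symbol there is such a triple.\<close>

lemma yields_triple_complete:
  assumes "\<And>N \<rho>. (N, \<rho>) \<in> P \<Longrightarrow> insert (Inl N) (set \<rho>) \<subseteq> Y"
  shows "yields P \<alpha> v \<Longrightarrow> set \<alpha> \<subseteq> Y \<Longrightarrow> run \<delta> q w v q' \<Longrightarrow> q \<in> Q \<Longrightarrow>
    \<exists>r w1 w2. \<exists>\<beta>\<in>annotate Q r \<alpha> q'. w = w1 @ w2 \<and> run \<delta> q w1 [] r \<and> yields triple_grammar \<beta> w2"
proof (induction arbitrary: q w q' rule: yields.induct)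
  case yields_Nil
  then show ?case
    by (intro exI[of _ q'] exI[of _ w] exI[of _ "[]"]) (auto intro: yields.intros)
next
  case (yields_terminal \<alpha> v a)
  from run_split[OF letterwise, of q w "[a]" v q'] yields_terminal.prems obtain r w1 w2 where
    r: "w = w1 @ w2" "run \<delta> q w1 [a] r" "run \<delta> r w2 v q'" by auto
  have rQ: "r \<in> Q" using run_in_states[OF r(2)] yields_terminal.prems by simp
  from yields_terminal.IH[OF _ r(3) rQ] yields_terminal.prems(1) obtain s w21 w22 \<beta> where
    s: "\<beta> \<in> annotate Q s \<alpha> q'" "w2 = w21 @ w22" "run \<delta> r w21 [] s" "yields triple_grammar \<beta> w22" by auto
  have "yields triple_grammar [Inl (q, Inr a, r)] w1"
    using r(2) yields_terminal.prems by (intro yields_triple_terminal) auto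
  then have "yields triple_grammar [Inl (q, Inr a, s)] (w1 @ w21)"
    using yields_terminal.prems by (intro yields_triple_silent_right[OF s(3)]) auto
  from yields_append[OF this s(4)] have "yields triple_grammar (Inl (q, Inr a, s) # \<beta>) w"
    using r(1) s(2) by simp
  moreover have "Inl (q, Inr a, s) # \<beta> \<in> annotate Q q (Inr a # \<alpha>) q'"
    using s(1) run_in_states[OF s(3) rQ] by auto
  ultimately show ?case
    by (intro exI[of _ q] exI[of _ "[]"] exI[of _ w] bexI) (auto intro: run_Nil)
next
  case (yields_nonterminal N \<rho> u \<alpha> v)
  from run_split[OF letterwise yields_nonterminal.prems(2)] obtain r w1 w2 where
    r: "w = w1 @ w2" "run \<delta> q w1 u r" "run \<delta> r w2 v q'" by auto
  have NY: "Inl N \<in> Y" "set \<rho> \<subseteq> Y" using assms[OF yields_nonterminal.hyps(1)] by auto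
  have rQ: "r \<in> Q" using run_in_states[OF r(2)] yields_nonterminal.prems by simp
  from yields_nonterminal.IH(2)[OF _ r(3) rQ] yields_nonterminal.prems(1) obtain s w21 w22 \<beta> where
    s: "\<beta> \<in> annotate Q s \<alpha> q'" "w2 = w21 @ w22" "run \<delta> r w21 [] s" "yields triple_grammar \<beta> w22" by auto
  from yields_nonterminal.IH(1)[OF NY(2) r(2) yields_nonterminal.prems(3)]
  obtain s' w11 w12 \<gamma> where
    s': "\<gamma> \<in> annotate Q s' \<rho> r" "w1 = w11 @ w12" "run \<delta> q w11 [] s'" "yields triple_grammar \<gamma> w12" by auto
  have s'Q: "s' \<in> Q" using run_in_states[OF s'(3) yields_nonterminal.prems(3)] .
  have "((s', Inl N, r), \<gamma>) \<in> triple_grammar"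
    unfolding triple_productions_def using yields_nonterminal.hyps(1) s'(1) s'Q rQ by fastforce
  then have "yields triple_grammar [Inl (s', Inl N, r)] w12"
    by (rule yields_production) (rule s'(4))
  then have "yields triple_grammar [Inl (s', Inl N, s)] (w12 @ w21)"
    using s'Q NY by (intro yields_triple_silent_right[OF s(3)]) auto
  then have "yields triple_grammar [Inl (q, Inl N, s)] (w11 @ w12 @ w21)"
    using NY run_in_states[OF s(3) rQ] by (intro yields_triple_silent_left[OF s'(3)]) auto
  from yields_append[OF this s(4)] have "yields triple_grammar (Inl (q, Inl N, s) # \<beta>) w"
    using r(1) s(2) s'(2) by simp
  moreover have "Inl (q, Inl N, s) # \<beta> \<in> annotate Q q (Inl N # \<alpha>) q'"
    using s(1) run_in_states[OF s(3) rQ] by auto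
  ultimately show ?case
    by (intro exI[of _ q] exI[of _ "[]"] exI[of _ w] bexI) (auto intro: run_Nil)
qed

end

lemma context_free_inverse_transduct_letterwise:
  fixes \<delta> :: "('q \<times> 'i list \<times> 'o list \<times> 'q) set"
  assumes "context_free L" "finite \<delta>" "letterwise \<delta>"
  shows "context_free (inverse_transduct \<delta> q q' L)"
proof -
  from assms(1) obtain P :: "(nat \<times> (nat + 'o) list) set" and S where P: "finite P" "L = {v. yields P [Inl S] v}"
    unfolding context_free_def derives_iff_yields by blast
  define Q where "Q = insert q (insert q' (states \<delta>))"
  define Y where "Y = insert (Inl S) (\<Union>(N, \<rho>)\<in>P. insert (Inl N) (set \<rho>))"
  let ?T = "triple_productions \<delta> Q Y P"
  have Q: "states \<delta> \<subseteq> Q" "q \<in> Q" "q' \<in> Q" "finite Q"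
    using assms(2) by (auto simp: Q_def finite_states)
  have Y: "finite Y" "Inl S \<in> Y" "\<And>N \<rho>. (N, \<rho>) \<in> P \<Longrightarrow> insert (Inl N) (set \<rho>) \<subseteq> Y"
    using P(1) by (auto simp: Y_def)
  have "inverse_transduct \<delta> q q' L = {w. yields ?T [Inl (q, Inl S, q')] w}"
  proof (intro equalityI subsetI)
    fix w assume "w \<in> inverse_transduct \<delta> q q' L"
    then obtain v where v: "yields P [Inl S] v" "run \<delta> q w v q'"
      by (auto simp: inverse_transduct_def P(2))
    from yields_triple_complete[OF assms(3) Q(1) Y(3) v(1) _ v(2) Q(2)] Y(2)
    obtain r w1 w2 \<beta> where *: "\<beta> \<in> annotate Q r [Inl S] q'" "w = w1 @ w2" "run \<delta> q w1 [] r" "yields ?T \<beta> w2"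
      by fastforce
    have "\<beta> = [Inl (r, Inl S, q')]" using *(1) by (auto split: if_splits)
    then show "w \<in> {w. yields ?T [Inl (q, Inl S, q')] w}"
      using yields_triple_silent_left[OF assms(3) Q(1) *(3) _ Y(2) Q(3)] *(2,4) by simp
  next
    fix w assume "w \<in> {w. yields ?T [Inl (q, Inl S, q')] w}"
    then have "realizes \<delta> P [Inl (q, Inl S, q')] w"
      by (auto dest: yields_triple_sound)
    then show "w \<in> inverse_transduct \<delta> q q' L"
      by (auto simp: inverse_transduct_def P(2))
  qed
  then show ?thesis
    using context_free_grammar[OF finite_triple_productions[OF assms(2) Q(4) Y(1) P(1)]] by simp
qed

theorem context_free_inverse_transduct:
  assumes "context_free L" "finite \<delta>"
  shows "context_free (inverse_transduct \<delta> q q' L)"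
  unfolding inverse_transduct_split_outputs[of \<delta>]
  using assms(1) finite_split_outputs[OF assms(2)] letterwise_split_outputs
  by (rule context_free_inverse_transduct_letterwise)


section \<open>The profinite topology\<close>

lemma (in group) inv_mult_cancel [simp]:
  assumes "x \<in> carrier G" "y \<in> carrier G"
  shows "inv x \<otimes> (x \<otimes> y) = y" "x \<otimes> (inv x \<otimes> y) = y"
  using assms by (simp_all flip: m_assoc)

lemma (in group) topspace_profinite: "topspace (profinite_topology G) = carrier G"
proof
  have "U \<subseteq> carrier G" if "U \<in> fi_cosets G" for U
  proof -
    from that obtain H g where "subgroup H G" "g \<in> carrier G" "U = H #> g"
      by (auto simp: fi_cosets_def finite_index_def)
    then show ?thesis using r_coset_subset_G[OF subgroup.subset] by blast
  qed
  then show "topspace (profinite_topology G) \<subseteq> carrier G"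
    using openin_topspace[of "profinite_topology G"]
    unfolding openin_profinite_topology union_of_def by fastforce
next
  have "rcosets (carrier G) \<subseteq> {carrier G}"
    by (auto simp: RCOSETS_def coset_join2[OF _ subgroup_self])
  then have "finite_index G (carrier G)"
    unfolding finite_index_def using subgroup_self finite_subset by blast
  then have "carrier G #> \<one> \<in> fi_cosets G"
    unfolding fi_cosets_def by blast
  then have "openin (profinite_topology G) (carrier G)"
    unfolding openin_profinite_topology
    by (simp add: coset_join2[OF _ subgroup_self] arbitrary_union_of_inc)
  then show "carrier G \<subseteq> topspace (profinite_topology G)"
    by (rule openin_subset)
qed

lemma (in group_hom) finite_index_preimage:
  assumes "finite_index H U"
  shows "finite_index G {x \<in> carrier G. h x \<in> U}" (is "finite_index G ?V")
proof -
  have U: "subgroup U H" using assms by (simp add: finite_index_def)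
  have V: "subgroup ?V G"
    by (rule G.subgroupI)
      (use U in \<open>auto simp: subgroup.m_closed subgroup.m_inv_closed subgroup.one_closed\<close>)
  have coset: "?V #>\<^bsub>G\<^esub> g = {x \<in> carrier G. h x \<in> U #>\<^bsub>H\<^esub> h g}" if g: "g \<in> carrier G" for g
  proof (intro equalityI subsetI)
    fix x assume "x \<in> ?V #>\<^bsub>G\<^esub> g"
    then show "x \<in> {x \<in> carrier G. h x \<in> U #>\<^bsub>H\<^esub> h g}"
      using g by (auto simp: r_coset_def)
  next
    fix x assume "x \<in> {x \<in> carrier G. h x \<in> U #>\<^bsub>H\<^esub> h g}"
    then obtain u where x: "x \<in> carrier G" "u \<in> U" "h x = u \<otimes>\<^bsub>H\<^esub> h g"
      by (auto simp: r_coset_def)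
    have "h (x \<otimes> inv g) = u"
      using g x subgroup.mem_carrier[OF U] by (simp add: H.m_assoc)
    then have "x \<otimes> inv g \<in> ?V" using g x by simp
    moreover have "x = (x \<otimes> inv g) \<otimes> g" using g x by (simp add: G.m_assoc)
    ultimately show "x \<in> ?V #>\<^bsub>G\<^esub> g" unfolding r_coset_def by blast
  qed
  have "rcosets\<^bsub>G\<^esub> ?V \<subseteq> (\<lambda>X. {x \<in> carrier G. h x \<in> X}) ` (rcosets\<^bsub>H\<^esub> U)"
    using coset by (fastforce simp: RCOSETS_def)
  then show ?thesis
    using V assms finite_subset unfolding finite_index_def by blast
qed

text \<open>The subgroup that witnesses openness at \<open>g\<close> is the preimage of the one that witnesses it at
  \<open>h(g) t\<close>, with the same coset representative.\<close>

lemma (in group_hom) continuous_map_profinite_translate: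
  assumes "t \<in> carrier H"
  shows "continuous_map (profinite_topology G) (profinite_topology H) (\<lambda>x. h x \<otimes>\<^bsub>H\<^esub> t)"
  unfolding continuous_map
proof (intro conjI allI impI)
  show "(\<lambda>x. h x \<otimes>\<^bsub>H\<^esub> t) ` topspace (profinite_topology G) \<subseteq> topspace (profinite_topology H)"
    using assms by (auto simp: G.topspace_profinite H.topspace_profinite)
  fix W assume W: "openin (profinite_topology H) W"
  show "openin (profinite_topology G) {x \<in> topspace (profinite_topology G). h x \<otimes>\<^bsub>H\<^esub> t \<in> W}"
  proof (subst openin_subopen, clarify)
    fix g assume "g \<in> topspace (profinite_topology G)" and "h g \<otimes>\<^bsub>H\<^esub> t \<in> W"
    then have g: "g \<in> carrier G" by (simp add: G.topspace_profinite)
    from W \<open>h g \<otimes>\<^bsub>H\<^esub> t \<in> W\<close> obtain C where C: "C \<in> fi_cosets H" "h g \<otimes>\<^bsub>H\<^esub> t \<in> C" "C \<subseteq> W"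
      unfolding H.openin_profinite_topology union_of_def by blast
    then obtain U y where U: "finite_index H U" "y \<in> carrier H" "C = U #>\<^bsub>H\<^esub> y"
      by (auto simp: fi_cosets_def)
    have sub: "subgroup U H" using U(1) by (simp add: finite_index_def)
    have C': "C = U #>\<^bsub>H\<^esub> (h g \<otimes>\<^bsub>H\<^esub> t)"
      using H.repr_independence[OF C(2)[unfolded U(3)] U(2) sub] U(3) by simp
    let ?V = "{x \<in> carrier G. h x \<in> U}"
    have "?V #>\<^bsub>G\<^esub> g \<in> fi_cosets G"
      using finite_index_preimage[OF U(1)] g unfolding fi_cosets_def by blast
    then have "openin (profinite_topology G) (?V #>\<^bsub>G\<^esub> g)"
      unfolding G.openin_profinite_topology by (rule arbitrary_union_of_inc)
    moreover have "g \<in> ?V #>\<^bsub>G\<^esub> g"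
      using g subgroup.one_closed[OF sub] G.l_one[OF g] unfolding r_coset_def by force
    moreover have "?V #>\<^bsub>G\<^esub> g \<subseteq> {x \<in> topspace (profinite_topology G). h x \<otimes>\<^bsub>H\<^esub> t \<in> W}"
    proof
      fix x assume "x \<in> ?V #>\<^bsub>G\<^esub> g"
      then obtain v where v: "v \<in> carrier G" "h v \<in> U" "x = v \<otimes> g" by (auto simp: r_coset_def)
      then have "h x \<otimes>\<^bsub>H\<^esub> t = h v \<otimes>\<^bsub>H\<^esub> (h g \<otimes>\<^bsub>H\<^esub> t)"
        using g assms by (simp add: H.m_assoc)
      then have "h x \<otimes>\<^bsub>H\<^esub> t \<in> C" using v(2) unfolding C' r_coset_def by blast
      then show "x \<in> {x \<in> topspace (profinite_topology G). h x \<otimes>\<^bsub>H\<^esub> t \<in> W}"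
        using C(3) v g by (auto simp: G.topspace_profinite)
    qed
    ultimately show "\<exists>T. openin (profinite_topology G) T \<and> g \<in> T \<and>
        T \<subseteq> {x \<in> topspace (profinite_topology G). h x \<otimes>\<^bsub>H\<^esub> t \<in> W}"
      by blast
  qed
qed

lemma (in group_hom) separable_preimage_translate:
  assumes "separable H C" "t \<in> carrier H"
  shows "separable G {x \<in> carrier G. h x \<otimes>\<^bsub>H\<^esub> t \<in> C}"
  using closedin_continuous_map_preimage[OF continuous_map_profinite_translate[OF assms(2)]] assms(1)
  by (simp add: separable_def G.topspace_profinite)


section \<open>Words and twisted conjugacy\<close>

context group
begin

lemma letter_val_closed [simp]: "A \<subseteq> carrier G \<Longrightarrow> fst l \<in> A \<Longrightarrow> letter_val G l \<in> carrier G"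
  by (cases l) auto

lemma word_val_Nil [simp]: "word_val G [] = \<one>"
  by (simp add: word_val_def)

lemma word_val_Cons [simp]: "word_val G (l # w) = letter_val G l \<otimes> word_val G w"
  by (simp add: word_val_def)

lemma word_val_closed [simp]: "A \<subseteq> carrier G \<Longrightarrow> w \<in> words A \<Longrightarrow> word_val G w \<in> carrier G"
  by (induction w) auto

lemma word_val_append:
  "A \<subseteq> carrier G \<Longrightarrow> u \<in> words A \<Longrightarrow> v \<in> words A \<Longrightarrow>
    word_val G (u @ v) = word_val G u \<otimes> word_val G v"
  by (induction u) (auto simp: m_assoc)

lemma generate_word:
  assumes "A \<subseteq> carrier G"
  shows "g \<in> generate G A \<Longrightarrow> \<exists>w\<in>words A. word_val G w = g"
proof (induction rule: generate.induct)
  case one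
  then show ?case by (intro bexI[of _ "[]"]) auto
next
  case (incl a)
  then show ?case using assms by (intro bexI[of _ "[(a, True)]"]) auto
next
  case (inv a)
  then show ?case using assms by (intro bexI[of _ "[(a, False)]"]) auto
next
  case (eng g1 g2)
  then obtain w1 w2 where "w1 \<in> words A" "word_val G w1 = g1" "w2 \<in> words A" "word_val G w2 = g2"
    by blast
  then show ?case using assms by (intro bexI[of _ "w1 @ w2"]) (auto simp: word_val_append)
qed

end

definition twisted_conj :: "('g, 'm) monoid_scheme \<Rightarrow> ('g \<Rightarrow> 'g) \<Rightarrow> 'g \<Rightarrow> 'g \<Rightarrow> bool" where
  "twisted_conj G \<phi> s g \<longleftrightarrow> s \<in> carrier G \<and> (\<exists>x\<in>carrier G. g = \<phi> (inv\<^bsub>G\<^esub> x) \<otimes>\<^bsub>G\<^esub> s \<otimes>\<^bsub>G\<^esub> x)"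

locale group_endo = group_hom G G \<phi> for G (structure) and \<phi>
begin

lemma twisted_conjI: "s \<in> carrier G \<Longrightarrow> x \<in> carrier G \<Longrightarrow> twisted_conj G \<phi> s (\<phi> (inv x) \<otimes> s \<otimes> x)"
  unfolding twisted_conj_def by blast

lemma twisted_conj_closed: "twisted_conj G \<phi> s g \<Longrightarrow> s \<in> carrier G \<and> g \<in> carrier G"
  unfolding twisted_conj_def by auto

lemma twisted_conj_refl: "s \<in> carrier G \<Longrightarrow> twisted_conj G \<phi> s s"
  using twisted_conjI[of s \<one>] by simp

lemma twisted_conj_trans [trans]:
  assumes "twisted_conj G \<phi> s g" "twisted_conj G \<phi> g g'"
  shows "twisted_conj G \<phi> s g'"
proof -
  from assms obtain x y where *: "s \<in> carrier G" "x \<in> carrier G" "y \<in> carrier G"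
    "g = \<phi> (inv x) \<otimes> s \<otimes> x" "g' = \<phi> (inv y) \<otimes> g \<otimes> y"
    by (auto simp: twisted_conj_def)
  then have "g' = \<phi> (inv (x \<otimes> y)) \<otimes> s \<otimes> (x \<otimes> y)"
    by (simp add: G.m_assoc G.inv_mult_group)
  with * show ?thesis using twisted_conjI[of s "x \<otimes> y"] by simp
qed

lemma twisted_conj_sym:
  assumes "twisted_conj G \<phi> s g"
  shows "twisted_conj G \<phi> g s"
proof -
  from assms obtain x where *: "s \<in> carrier G" "x \<in> carrier G" "g = \<phi> (inv x) \<otimes> s \<otimes> x"
    by (auto simp: twisted_conj_def)
  have "\<phi> (inv (inv x)) \<otimes> g \<otimes> inv x = s"
    unfolding *(3) using *(1,2) by (simp add: G.m_assoc)
  with *(2) show ?thesis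
    using twisted_conjI[of g "inv x"] twisted_conj_closed[OF assms] by simp
qed

text \<open>The conjugating element is \<open>s\<^sup>-\<^sup>1\<close>: \<open>\<phi>(s) s s\<^sup>-\<^sup>1 = \<phi>(s)\<close>.\<close>

lemma twisted_conj_endo: "s \<in> carrier G \<Longrightarrow> twisted_conj G \<phi> s (\<phi> s)"
  using twisted_conjI[of s "inv s"] by (simp add: G.m_assoc)

lemma funpow_closed [simp]: "s \<in> carrier G \<Longrightarrow> (\<phi> ^^ i) s \<in> carrier G"
  by (induction i) auto

lemma twisted_conj_funpow: "s \<in> carrier G \<Longrightarrow> twisted_conj G \<phi> s ((\<phi> ^^ i) s)"
proof (induction i)
  case (Suc i)
  then show ?case using twisted_conj_trans[OF Suc.IH twisted_conj_endo] by simp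
qed (simp add: twisted_conj_refl)

end


section \<open>Extensions by a root of an inner automorphism\<close>

text \<open>What the proof needs to know about \<open>E = G\<^sup>\<phi>\<close> and the natural map \<open>h\<close>. The map need not be
  injective; its kernel is controlled by a finite set \<open>D\<close> whose subgroup is absorbed by every twisted
  conjugacy class. \<open>D\<close> is finite so that a finite transducer can insert arbitrary
  elements of the kernel.\<close>

locale root_extension =
  group_hom G E h + phi: group_endo G \<phi>
  for G :: "('g, 'm) monoid_scheme" and E :: "('e, 'n) monoid_scheme" and h :: "'g \<Rightarrow> 'e" and \<phi> :: "'g \<Rightarrow> 'g" +
  fixes t :: 'e and p :: nat and \<Delta> :: 'g and D :: "'g set"
  assumes t_closed [simp]: "t \<in> carrier E"
    and p_pos: "p > 0"
    and Delta_closed [simp]: "\<Delta> \<in> carrier G"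
    and root: "t [^]\<^bsub>E\<^esub> p = h \<Delta>"
    and conj: "g \<in> carrier G \<Longrightarrow> h g \<otimes>\<^bsub>E\<^esub> t = t \<otimes>\<^bsub>E\<^esub> h (\<phi> g)"
    and generated: "generate E (insert t (h ` carrier G)) = carrier E"
    and finite_D: "finite D"
    and D_closed: "D \<subseteq> carrier G"
    and h_D: "d \<in> D \<Longrightarrow> h d = \<one>\<^bsub>E\<^esub>"
    and normal_form: "\<lbrakk>i < p; j < p; g \<in> carrier G; g' \<in> carrier G;
      t [^]\<^bsub>E\<^esub> i \<otimes>\<^bsub>E\<^esub> h g = t [^]\<^bsub>E\<^esub> j \<otimes>\<^bsub>E\<^esub> h g'\<rbrakk> \<Longrightarrow> i = j \<and> (\<exists>n\<in>generate G D. g' = g \<otimes>\<^bsub>G\<^esub> n)"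
    and absorbed: "\<lbrakk>n \<in> generate G D; s \<in> carrier G\<rbrakk> \<Longrightarrow> twisted_conj G \<phi> s (s \<otimes>\<^bsub>G\<^esub> n)"
begin

lemma conj_pow: "g \<in> carrier G \<Longrightarrow> h g \<otimes>\<^bsub>E\<^esub> t [^]\<^bsub>E\<^esub> (i::nat) = t [^]\<^bsub>E\<^esub> i \<otimes>\<^bsub>E\<^esub> h ((\<phi> ^^ i) g)"
proof (induction i)
  case (Suc i)
  have "h g \<otimes>\<^bsub>E\<^esub> t [^]\<^bsub>E\<^esub> Suc i = (h g \<otimes>\<^bsub>E\<^esub> t [^]\<^bsub>E\<^esub> i) \<otimes>\<^bsub>E\<^esub> t"
    using Suc.prems by (simp add: H.m_assoc)
  also have "\<dots> = t [^]\<^bsub>E\<^esub> i \<otimes>\<^bsub>E\<^esub> (h ((\<phi> ^^ i) g) \<otimes>\<^bsub>E\<^esub> t)"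
    using Suc by (simp add: H.m_assoc)
  also have "\<dots> = t [^]\<^bsub>E\<^esub> Suc i \<otimes>\<^bsub>E\<^esub> h ((\<phi> ^^ Suc i) g)"
    using Suc.prems by (simp add: conj H.m_assoc)
  finally show ?case .
qed simp

lemma kernel_h: "g \<in> carrier G \<Longrightarrow> g' \<in> carrier G \<Longrightarrow> h g = h g' \<Longrightarrow> \<exists>n\<in>generate G D. g' = g \<otimes>\<^bsub>G\<^esub> n"
  using normal_form[of 0 0 g g'] p_pos by simp

text \<open>Elements of \<open>E\<close> have normal forms \<open>t\<^sup>i h(g)\<close> with \<open>i < p\<close>. Multiplying such a form on the left by
  one letter changes the exponent and puts one of finitely many factors in front of \<open>g\<close>; for the
  letters \<open>t\<close> and \<open>t\<^sup>-\<^sup>1\<close> the factor is the carry caused by \<open>t\<^sup>p = h(\<Delta>)\<close>.\<close>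

lemma t_letter:
  assumes "j < p" "l = (t, b)"
  shows "\<exists>i<p. \<exists>g\<in>{\<one>\<^bsub>G\<^esub>, \<Delta>, inv\<^bsub>G\<^esub> \<Delta>}. letter_val E l \<otimes>\<^bsub>E\<^esub> t [^]\<^bsub>E\<^esub> j = t [^]\<^bsub>E\<^esub> i \<otimes>\<^bsub>E\<^esub> h g"
proof (cases b)
  case True
  have eq: "letter_val E l \<otimes>\<^bsub>E\<^esub> t [^]\<^bsub>E\<^esub> j = t [^]\<^bsub>E\<^esub> Suc j"
    using assms(2) True by (simp only: letter_val.simps if_True H.nat_pow_Suc2[OF t_closed])
  show ?thesis
  proof (cases "Suc j = p")
    case True
    then show ?thesis
      using eq root p_pos by (intro exI[of _ 0] conjI bexI[of _ \<Delta>]) (auto)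
  next
    case False
    then show ?thesis
      using eq assms by (intro exI[of _ "Suc j"] conjI bexI[of _ "\<one>\<^bsub>G\<^esub>"]) (auto)
  qed
next
  case False
  show ?thesis
  proof (cases j)
    case 0
    have "t [^]\<^bsub>E\<^esub> p = t \<otimes>\<^bsub>E\<^esub> t [^]\<^bsub>E\<^esub> (p - 1)"
      using H.nat_pow_Suc2[OF t_closed, of "p - 1"] p_pos by simp
    then have "inv\<^bsub>E\<^esub> t \<otimes>\<^bsub>E\<^esub> t [^]\<^bsub>E\<^esub> p = t [^]\<^bsub>E\<^esub> (p - 1)" by simp
    then have "inv\<^bsub>E\<^esub> t \<otimes>\<^bsub>E\<^esub> h \<Delta> = t [^]\<^bsub>E\<^esub> (p - 1)" using root by simp
    then have "t [^]\<^bsub>E\<^esub> (p - 1) \<otimes>\<^bsub>E\<^esub> h (inv\<^bsub>G\<^esub> \<Delta>) = inv\<^bsub>E\<^esub> t"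
      by (metis Delta_closed H.inv_closed H.inv_solve_right' H.m_assoc H.r_inv H.r_one hom_closed
          hom_inv t_closed)
    then show ?thesis
      using 0 assms False p_pos
      by (intro exI[of _ "p - 1"] conjI bexI[of _ "inv\<^bsub>G\<^esub> \<Delta>"]) (auto)
  next
    case (Suc i)
    then have "inv\<^bsub>E\<^esub> t \<otimes>\<^bsub>E\<^esub> t [^]\<^bsub>E\<^esub> j = t [^]\<^bsub>E\<^esub> i"
      using H.nat_pow_Suc2[OF t_closed, of i] by simp
    then show ?thesis
      using Suc assms False
      by (intro exI[of _ i] conjI bexI[of _ "\<one>\<^bsub>G\<^esub>"]) (auto)
  qed
qed

definition letter_outputs :: "'g set \<Rightarrow> 'g set" where
  "letter_outputs B = {\<one>\<^bsub>G\<^esub>, \<Delta>, inv\<^bsub>G\<^esub> \<Delta>} \<union>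
     (\<lambda>(i, l). (\<phi> ^^ i) (letter_val G l)) ` ({..<p} \<times> (B \<times> UNIV))"

lemma letter_outputs_closed: "B \<subseteq> carrier G \<Longrightarrow> letter_outputs B \<subseteq> carrier G"
  by (auto simp: letter_outputs_def simp del: letter_val.simps)

lemma E_letter:
  assumes "j < p" "fst l \<in> insert t (h ` B)" "B \<subseteq> carrier G"
  shows "\<exists>i<p. \<exists>g\<in>letter_outputs B. letter_val E l \<otimes>\<^bsub>E\<^esub> t [^]\<^bsub>E\<^esub> j = t [^]\<^bsub>E\<^esub> i \<otimes>\<^bsub>E\<^esub> h g"
proof -
  obtain y b where l: "l = (y, b)" by force
  show ?thesis
  proof (cases "y = t")
    case True
    with t_letter[OF assms(1), of l b] l show ?thesis unfolding letter_outputs_def by blast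
  next
    case False
    with assms(2) l obtain a where a: "a \<in> B" "y = h a" by auto
    then have "letter_val E l = h (letter_val G (a, b))" "letter_val G (a, b) \<in> carrier G"
      using assms(3) l by auto
    then have "letter_val E l \<otimes>\<^bsub>E\<^esub> t [^]\<^bsub>E\<^esub> j = t [^]\<^bsub>E\<^esub> j \<otimes>\<^bsub>E\<^esub> h ((\<phi> ^^ j) (letter_val G (a, b)))"
      by (simp only: conj_pow)
    moreover have "(\<phi> ^^ j) (letter_val G (a, b)) \<in>
letter_outputs B"
      unfolding letter_outputs_def using a(1) assms(1) by (intro UnI2 image_eqI[of _ _ "(j, (a, b))"]) auto
    ultimately show ?thesis using assms(1) by blast
  qed
qed

lemma ex_normal_form:
  assumes "y \<in> carrier E"
  shows "\<exists>i<p. \<exists>g\<in>carrier G. y = t [^]\<^bsub>E\<^esub> i \<otimes>\<^bsub>E\<^esub> h g"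
proof -
  let ?B = "insert t (h ` carrier G)"
  have B: "?B \<subseteq> carrier E" by auto
  from H.generate_word[OF B, of y] generated assms obtain w where
    "w \<in> words ?B" "word_val E w = y" by blast
  then show ?thesis
  proof (induction w arbitrary: y)
    case Nil
    then show ?case using p_pos by (intro exI[of _ 0] conjI bexI[of _ "\<one>\<^bsub>G\<^esub>"]) auto
  next
    case (Cons l w)
    then obtain j g where j: "j < p" "g \<in> carrier G" "word_val E w = t [^]\<^bsub>E\<^esub> j \<otimes>\<^bsub>E\<^esub> h g"
      by auto
    have l: "letter_val E l \<in> carrier E"
      using Cons.prems(1) by (intro H.letter_val_closed[OF B]) simp
    have "fst l \<in> ?B" using Cons.prems(1) by simp
    from E_letter[OF j(1) this subset_refl] obtain i g' where i: "i < p"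
      "g' \<in> letter_outputs (carrier G)"
      "letter_val E l \<otimes>\<^bsub>E\<^esub> t [^]\<^bsub>E\<^esub> j = t [^]\<^bsub>E\<^esub> i \<otimes>\<^bsub>E\<^esub> h g'"
      by (elim exE conjE bexE) (rule that)
    have g': "g' \<in> carrier G" using i(2) letter_outputs_closed by blast
    have "y = (letter_val E l \<otimes>\<^bsub>E\<^esub> t [^]\<^bsub>E\<^esub> j) \<otimes>\<^bsub>E\<^esub> h g"
      using Cons.prems(2) j l by (simp add: H.m_assoc)
    also have "\<dots> = t [^]\<^bsub>E\<^esub> i \<otimes>\<^bsub>E\<^esub> h (g' \<otimes>\<^bsub>G\<^esub> g)"
      unfolding i(3) using g' j by (simp add: H.m_assoc)
    finally show ?case using i(1) g' j(2) G.m_closed by blast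
  qed
qed

abbreviation shift :: "'g \<Rightarrow> 'e" where
  "shift g \<equiv> t \<otimes>\<^bsub>E\<^esub> h g"

text \<open>The computation behind everything: in the coset \<open>t h(G)\<close>, conjugacy in \<open>E\<close> is twisted conjugacy
  in \<open>G\<close>, up to a power of \<open>\<phi>\<close> that stays inside the class.\<close>

lemma conj_shift:
  assumes "x \<in> carrier G" "s \<in> carrier G"
  shows "inv\<^bsub>E\<^esub> (t [^]\<^bsub>E\<^esub> (i::nat) \<otimes>\<^bsub>E\<^esub> h x) \<otimes>\<^bsub>E\<^esub> shift s \<otimes>\<^bsub>E\<^esub> (t [^]\<^bsub>E\<^esub> i \<otimes>\<^bsub>E\<^esub> h x) =
    shift (\<phi> (inv\<^bsub>G\<^esub> x) \<otimes>\<^bsub>G\<^esub> (\<phi> ^^ i) s \<otimes>\<^bsub>G\<^esub> x)"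
proof -
  have "shift s \<otimes>\<^bsub>E\<^esub> t [^]\<^bsub>E\<^esub> i = t \<otimes>\<^bsub>E\<^esub> (t [^]\<^bsub>E\<^esub> i \<otimes>\<^bsub>E\<^esub> h ((\<phi> ^^ i) s))"
    using assms by (simp add: H.m_assoc conj_pow)
  also have "\<dots> = t [^]\<^bsub>E\<^esub> i \<otimes>\<^bsub>E\<^esub> shift ((\<phi> ^^ i) s)"
    using assms H.nat_pow_Suc2[OF t_closed, of i] by (simp flip: H.m_assoc)
  finally have 1: "shift s \<otimes>\<^bsub>E\<^esub> t [^]\<^bsub>E\<^esub> i = t [^]\<^bsub>E\<^esub> i \<otimes>\<^bsub>E\<^esub> shift ((\<phi> ^^ i) s)" .
  have "inv\<^bsub>E\<^esub> (t [^]\<^bsub>E\<^esub> i \<otimes>\<^bsub>E\<^esub> h x) \<otimes>\<^bsub>E\<^esub> shift s \<otimes>\<^bsub>E\<^esub> (t [^]\<^bsub>E\<^esub> i \<otimes>\<^bsub>E\<^esub> h x) =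
      inv\<^bsub>E\<^esub> (h x) \<otimes>\<^bsub>E\<^esub> (inv\<^bsub>E\<^esub> (t [^]\<^bsub>E\<^esub> i) \<otimes>\<^bsub>E\<^esub> ((shift s \<otimes>\<^bsub>E\<^esub> t [^]\<^bsub>E\<^esub> i) \<otimes>\<^bsub>E\<^esub> h x))"
    using assms by (simp add: H.m_assoc H.inv_mult_group)
  also have "\<dots> = (h (inv\<^bsub>G\<^esub> x) \<otimes>\<^bsub>E\<^esub> t) \<otimes>\<^bsub>E\<^esub> (h ((\<phi> ^^ i) s) \<otimes>\<^bsub>E\<^esub> h x)"
    unfolding 1 using assms by (simp add: H.m_assoc)
  also have "\<dots> = shift (\<phi> (inv\<^bsub>G\<^esub> x) \<otimes>\<^bsub>G\<^esub> (\<phi> ^^ i) s \<otimes>\<^bsub>G\<^esub> x)"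
    using assms conj[of "inv\<^bsub>G\<^esub> x"] by (simp add: H.m_assoc)
  finally show ?thesis .
qed

definition conj_closure :: "'e set \<Rightarrow> 'e set" where
  "conj_closure K = {inv\<^bsub>E\<^esub> y \<otimes>\<^bsub>E\<^esub> s \<otimes>\<^bsub>E\<^esub> y | y s. y \<in> carrier E \<and> s \<in> K}"

definition twisted_closure :: "'g set \<Rightarrow> 'g set" where
  "twisted_closure K = {\<phi> (inv\<^bsub>G\<^esub> x) \<otimes>\<^bsub>G\<^esub> s \<otimes>\<^bsub>G\<^esub> x | x s. x \<in> carrier G \<and> s \<in> K}"

lemma twisted_closure_eq_preimage:
  assumes "K \<subseteq> carrier G"
  shows "twisted_closure K = {g \<in> carrier G. shift g \<in> conj_closure (shift ` K)}"
proof (intro equalityI subsetI)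
  fix g assume "g \<in> twisted_closure K"
  then obtain x s where *: "x \<in> carrier G" "s \<in> K" "g = \<phi> (inv\<^bsub>G\<^esub> x) \<otimes>\<^bsub>G\<^esub> s \<otimes>\<^bsub>G\<^esub> x"
    by (auto simp: twisted_closure_def)
  have s: "s \<in> carrier G" using *(2) assms by blast
  have "shift g = inv\<^bsub>E\<^esub> (h x) \<otimes>\<^bsub>E\<^esub> shift s \<otimes>\<^bsub>E\<^esub> h x"
    using conj_shift[OF *(1) s, of 0] * s by simp
  moreover have "h x \<in> carrier E" "shift s \<in> shift ` K" using * by auto
  ultimately have "shift g \<in> conj_closure (shift ` K)" unfolding conj_closure_def by blast
  then show "g \<in> {g \<in> carrier G. shift g \<in> conj_closure (shift ` K)}" using * s by simp
next
  fix g assume "g \<in> {g \<in> carrier G. shift g \<in> conj_closure (shift ` K)}"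
  then obtain y s where g: "g \<in> carrier G" and y: "y \<in> carrier E" "s \<in> K"
    "shift g = inv\<^bsub>E\<^esub> y \<otimes>\<^bsub>E\<^esub> shift s \<otimes>\<^bsub>E\<^esub> y"
    by (auto simp: conj_closure_def)
  have s: "s \<in> carrier G" using y(2) assms by blast
  from ex_normal_form[OF y(1)] obtain i :: nat and x where x: "x \<in> carrier G" "y = t [^]\<^bsub>E\<^esub> i \<otimes>\<^bsub>E\<^esub> h x"
    by blast
  let ?g = "\<phi> (inv\<^bsub>G\<^esub> x) \<otimes>\<^bsub>G\<^esub> (\<phi> ^^ i) s \<otimes>\<^bsub>G\<^esub> x"
  have "shift g = shift ?g"
    using y(3) conj_shift[OF x(1) s, of i] x(2) by simp
  then have "h ?g = h g" using g x s by simp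
  with kernel_h[of ?g g] g x s obtain n where n: "n \<in> generate G D" "g = ?g \<otimes>\<^bsub>G\<^esub> n" by auto
  have "twisted_conj G \<phi> s ?g"
    using phi.twisted_conj_trans[OF phi.twisted_conj_funpow[OF s] phi.twisted_conjI] x s by simp
  moreover have "twisted_conj G \<phi> ?g g"
    using absorbed[OF n(1), of ?g] x s n(2) by simp
  ultimately have "twisted_conj G \<phi> s g" by (rule phi.twisted_conj_trans)
  then show "g \<in> twisted_closure K"
    using y(2) unfolding twisted_conj_def twisted_closure_def by blast
qed

text \<open>The map \<open>g \<mapsto> t h(g)\<close> is a right translate of the homomorphism \<open>g \<mapsto> t h(g) t\<^sup>-\<^sup>1\<close>, which
  makes it continuous and lets it carry right cosets to right cosets.\<close>

lemma conj_t_hom: "group_hom G E (\<lambda>g. t \<otimes>\<^bsub>E\<^esub> h g \<otimes>\<^bsub>E\<^esub> inv\<^bsub>E\<^esub> t)"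
  by unfold_locales (auto simp: hom_def H.m_assoc)

lemma shift_eq: "g \<in> carrier G \<Longrightarrow> shift g = t \<otimes>\<^bsub>E\<^esub> h g \<otimes>\<^bsub>E\<^esub> inv\<^bsub>E\<^esub> t \<otimes>\<^bsub>E\<^esub> t"
  by (simp add: H.m_assoc)

lemma separable_twisted_closure:
  assumes "K \<subseteq> carrier G" "separable E (conj_closure (shift ` K))"
  shows "separable G (twisted_closure K)"
proof -
  have "twisted_closure K =
      {g \<in> carrier G. t \<otimes>\<^bsub>E\<^esub> h g \<otimes>\<^bsub>E\<^esub> inv\<^bsub>E\<^esub> t \<otimes>\<^bsub>E\<^esub> t \<in> conj_closure (shift ` K)}"
    unfolding twisted_closure_eq_preimage[OF assms(1)] using shift_eq by auto
  then show ?thesis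
    using group_hom.separable_preimage_translate[OF conj_t_hom assms(2) t_closed] by simp
qed

lemma shift_Fin: "K \<in> Fin_sets G \<Longrightarrow> shift ` K \<in> Fin_sets E"
  by (auto simp: Fin_sets_def)

lemma shift_Coset:
  assumes "K \<in> Coset_sets G"
  shows "shift ` K \<in> Coset_sets E"
proof -
  from assms obtain S g where S: "finite S" "S \<subseteq> carrier G" "g \<in> carrier G"
    "K = generate G S #>\<^bsub>G\<^esub> g \<or> K = g <#\<^bsub>G\<^esub> generate G S"
    by (auto simp: Coset_sets_def)
  note carr = G.generate_in_carrier[OF S(2)]
  from S(4) show ?thesis
  proof
    assume K: "K = generate G S #>\<^bsub>G\<^esub> g"
    let ?c = "\<lambda>g. t \<otimes>\<^bsub>E\<^esub> h g \<otimes>\<^bsub>E\<^esub> inv\<^bsub>E\<^esub> t"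
    have "shift (x \<otimes>\<^bsub>G\<^esub> g) = ?c x \<otimes>\<^bsub>E\<^esub> shift g" if "x \<in> generate G S" for x
      using carr[OF that] S(3) by (simp add: H.m_assoc)
    then have "shift ` K = generate E (?c ` S) #>\<^bsub>E\<^esub> shift g"
      unfolding K r_coset_def group_hom.generate_img[OF conj_t_hom S(2)]
      by (simp add: image_UN)
    moreover have "finite (?c ` S)" "?c ` S \<subseteq> carrier E" "shift g \<in> carrier E" using S by auto
    ultimately show ?thesis unfolding Coset_sets_def by blast
  next
    assume K: "K = g <#\<^bsub>G\<^esub> generate G S"
    have "shift (g \<otimes>\<^bsub>G\<^esub> x) = shift g \<otimes>\<^bsub>E\<^esub> h x" if "x \<in> generate G S" for x
      using carr[OF that] S(3) by (simp add: H.m_assoc)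
    then have "shift ` K = shift g <#\<^bsub>E\<^esub> generate E (h ` S)"
      unfolding K l_coset_def generate_img[OF S(2)]
      by (simp add: image_UN)
    moreover have "finite (h ` S)" "h ` S \<subseteq> carrier E" "shift g \<in> carrier E" using S by auto
    ultimately show ?thesis unfolding Coset_sets_def by blast
  qed
qed

end

section \<open>Rewriting words of the extension by a transducer\<close>

locale generated_root_extension = root_extension G E h \<phi> t p \<Delta> D
  for G :: "('g, 'm) monoid_scheme" and E :: "('e, 'n) monoid_scheme" and h \<phi> t p \<Delta> D +
  fixes A :: "'g set"
  assumes gens: "finite_gen_set G A"
begin

lemma A_closed: "A \<subseteq> carrier G" and finite_A: "finite A" and generate_A: "generate G A = carrier G"
  using gens by (simp_all add: finite_gen_set_def)

definition spell :: "'g \<Rightarrow> 'g word" where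
  "spell g = (SOME w. w \<in> words A \<and> word_val G w = g)"

lemma spell:
  assumes "g \<in> carrier G"
  shows "spell g \<in> words A" "word_val G (spell g) = g"
proof -
  have "\<exists>w. w \<in> words A \<and> word_val G w = g"
    using G.generate_word[OF A_closed] generate_A assms by blast
  then have "spell g \<in> words A \<and> word_val G (spell g) = g"
    unfolding spell_def by (rule someI_ex)
  then show "spell g \<in> words A" "word_val G (spell g) = g" by simp_all
qed

definition outputs :: "'g set" where
  "outputs = letter_outputs A \<union> D \<union> m_inv G ` D"

abbreviation gens_E :: "'e set" where
  "gens_E \<equiv> insert t (h ` A)"

text \<open>The transducer turns words over the generators of \<open>E\<close> into words over \<open>A\<close>. Its states are
  exponents, and a transition from \<open>i\<close> to \<open>j\<close> that reads \<open>x\<close> and writes \<open>v\<close> records the equation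
  \<open>x t\<^sup>j = t\<^sup>i h(v)\<close> in \<open>E\<close>; these equations compose along runs. So the state \<open>i\<close> is a guess that the
  rest of the input has exponent \<open>i\<close>, and a run from \<open>1\<close> to \<open>0\<close> certifies that the input has value
  \<open>t h(v)\<close>. The exponent \<open>p\<close> is admitted so that \<open>1\<close> is a state when \<open>p = 1\<close>.\<close>

definition rewriter :: "(nat \<times> 'e word \<times> 'g word \<times> nat) set" where
  "rewriter = {(i, x, spell g, j) | i x g j. i \<le> p \<and> j \<le> p \<and>
     x \<in> insert [] ((\<lambda>l. [l]) ` (gens_E \<times> UNIV)) \<and> g \<in> outputs \<and>
     word_val E x \<otimes>\<^bsub>E\<^esub> t [^]\<^bsub>E\<^esub> j = t [^]\<^bsub>E\<^esub> i \<otimes>\<^bsub>E\<^esub> h g}"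

lemma rewriterI:
  assumes "i \<le> p" "j \<le> p" "x = [] \<or> (\<exists>l. fst l \<in> gens_E \<and> x = [l])" "g \<in> outputs"
    "word_val E x \<otimes>\<^bsub>E\<^esub> t [^]\<^bsub>E\<^esub> j = t [^]\<^bsub>E\<^esub> i \<otimes>\<^bsub>E\<^esub> h g"
  shows "(i, x, spell g, j) \<in> rewriter"
proof -
  have "x \<in> insert [] ((\<lambda>l. [l]) ` (gens_E \<times> UNIV))"
    using assms(3) by (auto simp: image_iff mem_Times_iff)
  with assms show ?thesis unfolding rewriter_def by blast
qed

lemma outputs_closed: "g \<in> outputs \<Longrightarrow> g \<in> carrier G"
  using D_closed letter_outputs_closed[OF A_closed] unfolding outputs_def by auto

lemma gens_E_closed: "gens_E \<subseteq> carrier E"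
  using A_closed by auto

lemma finite_gen_set_E: "finite_gen_set E gens_E"
proof -
  have "h ` carrier G = generate E (h ` A)"
    using generate_img[OF A_closed] generate_A by simp
  also have "\<dots> \<subseteq> generate E gens_E"
    by (rule H.mono_generate) auto
  finally have "insert t (h ` carrier G) \<subseteq> generate E gens_E"
    by (auto intro: generate.incl)
  then have "carrier E \<subseteq> generate E gens_E"
    using H.generate_subgroup_incl[OF _ H.generate_is_subgroup[OF gens_E_closed]] generated by blast
  then show ?thesis
    using H.generate_incl[OF gens_E_closed] finite_A gens_E_closed unfolding finite_gen_set_def by auto
qed

lemma finite_rewriter: "finite rewriter"
proof (rule finite_subset)
  have "finite outputs" using finite_D finite_A by (auto simp: outputs_def letter_outputs_def)
  then show "finite ({..p} \<times> insert [] ((\<lambda>l. [l]) ` (gens_E \<times> (UNIV :: bool set))) \<times> spell ` outputs \<times> {..p})"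
    using finite_A by simp
  show "rewriter \<subseteq> {..p} \<times> insert [] ((\<lambda>l. [l]) ` (gens_E \<times> (UNIV :: bool set))) \<times> spell ` outputs \<times> {..p}"
    unfolding rewriter_def by auto
qed

lemma run_rewriter_sound:
  "run rewriter i w v j \<Longrightarrow> w \<in> words gens_E \<and> v \<in> words A \<and>
    word_val E w \<otimes>\<^bsub>E\<^esub> t [^]\<^bsub>E\<^esub> j = t [^]\<^bsub>E\<^esub> i \<otimes>\<^bsub>E\<^esub> h (word_val G v)"
proof (induction rule: run.induct)
  case (run_step i x v k w u j)
  then obtain g where g: "v = spell g" "x \<in> words gens_E" "g \<in> outputs"
    "word_val E x \<otimes>\<^bsub>E\<^esub> t [^]\<^bsub>E\<^esub> k = t [^]\<^bsub>E\<^esub> i \<otimes>\<^bsub>E\<^esub> h g"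
    by (auto simp: rewriter_def simp del: letter_val.simps)
  note gC = outputs_closed[OF g(3)]
  have u: "u \<in> words A" and w: "w \<in> words gens_E" using run_step.IH by auto
  have "word_val E (x @ w) \<otimes>\<^bsub>E\<^esub> t [^]\<^bsub>E\<^esub> j = word_val E x \<otimes>\<^bsub>E\<^esub> (word_val E w \<otimes>\<^bsub>E\<^esub> t [^]\<^bsub>E\<^esub> j)"
    using g(2) w H.word_val_closed[OF gens_E_closed] H.word_val_append[OF gens_E_closed g(2) w]
    by (simp add: H.m_assoc)
  also have "\<dots> = (word_val E x \<otimes>\<^bsub>E\<^esub> t [^]\<^bsub>E\<^esub> k) \<otimes>\<^bsub>E\<^esub> h (word_val G u)"
    using run_step.IH g(2) H.word_val_closed[OF gens_E_closed] G.word_val_closed[OF A_closed u]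
    by (simp add: H.m_assoc)
  also have "\<dots> = t [^]\<^bsub>E\<^esub> i \<otimes>\<^bsub>E\<^esub> h (word_val G (v @ u))"
    unfolding g(4) using spell[OF gC] gC G.word_val_closed[OF A_closed u] g(1)
      G.word_val_append[OF A_closed spell(1)[OF gC] u]
    by (simp add: H.m_assoc)
  finally show ?case using g(1,2) u w spell[OF gC] by simp
qed simp

text \<open>The exponents are determined from right to left, starting with \<open>0\<close> for the empty word.\<close>

lemma run_rewriter_complete:
  "w \<in> words gens_E \<Longrightarrow> \<exists>i<p. \<exists>v. run rewriter i w v 0"
proof (induction w)
  case Nil
  show ?case using p_pos by (intro exI[of _ 0] exI[of _ "[]"] conjI run_Nil)
next
  case (Cons l w)
  then obtain j v where j: "j < p" "run rewriter j w v 0" by auto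
  have l: "fst l \<in> gens_E" using Cons.prems by simp
  from E_letter[OF j(1) l A_closed] obtain i g where
    i: "i < p" "g \<in> outputs" "letter_val E l \<otimes>\<^bsub>E\<^esub> t [^]\<^bsub>E\<^esub> j = t [^]\<^bsub>E\<^esub> i \<otimes>\<^bsub>E\<^esub> h g"
    unfolding outputs_def by blast
  have "letter_val E l \<in> carrier E"
    using l by (rule H.letter_val_closed[OF gens_E_closed])
  then have "(i, [l], spell g, j) \<in> rewriter"
    using i j(1) by (intro rewriterI disjI2 exI[of _ l] conjI l) simp_all
  from run_step[OF this j(2)] show ?case using i(1) by auto
qed

text \<open>As \<open>h\<close> is trivial on \<open>D\<close>, there are loops that read nothing and write an element of \<open>D\<close> or its
  inverse.\<close>

lemma run_rewriter_kernel:
  "n \<in> generate G D \<Longrightarrow> \<exists>v. run rewriter 0 [] v 0 \<and> word_val G v = n"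
proof (induction rule: generate.induct)
  case one
  show ?case by (intro exI[of _ "[]"]) (simp add: run_Nil)
next
  case (incl d)
  then have "d \<in> carrier G" using D_closed by auto
  moreover have "(0, [], spell d, 0) \<in> rewriter"
    using incl h_D by (intro rewriterI) (simp_all add: outputs_def)
  ultimately show ?case by (intro exI[of _ "spell d"] conjI run_single spell(2))
next
  case (inv d)
  then have d: "d \<in> carrier G" using D_closed by auto
  then have "(0, [], spell (inv\<^bsub>G\<^esub> d), 0) \<in> rewriter"
    using inv h_D by (intro rewriterI) (simp_all add: outputs_def)
  with d show ?case by (intro exI[of _ "spell (inv\<^bsub>G\<^esub> d)"] conjI run_single spell(2) G.inv_closed)
next
  case (eng n n')
  then obtain v v' where v: "run rewriter 0 [] v 0" "word_val G v = n" "run rewriter 0 [] v' 0"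
    "word_val G v' = n'" by blast
  have "run rewriter 0 [] (v @ v') 0" using run_append[OF v(1,3)] by simp
  moreover have "word_val G (v @ v') = n \<otimes>\<^bsub>G\<^esub> n'"
    using run_rewriter_sound[OF v(1)] run_rewriter_sound[OF v(3)] G.word_val_append[OF A_closed] v(2,4)
    by simp
  ultimately show ?case by blast
qed

text \<open>A word with value \<open>t h(k)\<close> is rewritten to some \<open>v\<close> with \<open>h(v) = h(k)\<close>, hence \<open>k = v n\<close> with \<open>n\<close>
  in the kernel, and the silent loops at \<open>0\<close> append a word for \<open>n\<close>. Conversely,
  inserted kernel elements do not affect \<open>h(v)\<close>.\<close>

lemma preimage_shift:
  assumes "K \<subseteq> carrier G"
  shows "preimage_lang E gens_E (shift ` K) = inverse_transduct rewriter 1 0 (preimage_lang G A K)"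
proof (intro equalityI subsetI)
  fix w assume "w \<in> inverse_transduct rewriter 1 0 (preimage_lang G A K)"
  then obtain v where v: "v \<in> words A" "word_val G v \<in> K" "run rewriter 1 w v 0"
    by (auto simp: inverse_transduct_def preimage_lang_def)
  with run_rewriter_sound[OF v(3)] H.word_val_closed[OF gens_E_closed]
  have "w \<in> words gens_E" "word_val E w = shift (word_val G v)" by auto
  with v show "w \<in> preimage_lang E gens_E (shift ` K)" by (auto simp: preimage_lang_def)
next
  fix w assume "w \<in> preimage_lang E gens_E (shift ` K)"
  then obtain k where w: "w \<in> words gens_E" and k: "k \<in> K" "word_val E w = shift k"
    by (auto simp: preimage_lang_def)
  have kC: "k \<in> carrier G" using k(1) assms by blast
  have "\<exists>v. run rewriter 1 w v 0"
  proof -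
    from run_rewriter_complete[OF w] obtain i v where i: "i < p" "run rewriter i w v 0" by blast
    with run_rewriter_sound[OF i(2)] H.word_val_closed[OF gens_E_closed w]
    have v: "v \<in> words A" "word_val E w = t [^]\<^bsub>E\<^esub> i \<otimes>\<^bsub>E\<^esub> h (word_val G v)" by auto
    note vC = G.word_val_closed[OF A_closed v(1)]
    show ?thesis
    \<comment> \<open>For \<open>p = 1\<close> the run found starts in \<open>0\<close>, and \<open>t\<^sup>0 = t h(\<Delta>\<^sup>-\<^sup>1)\<close> gives a silent transition from \<open>1\<close> to \<open>0\<close>.\<close>
    proof (cases "p = 1")
      case False
      then have "i = 1"
        using normal_form[of i 1 "word_val G v" k] i(1) p_pos v(2) k(2) kC vC by simp
      then show ?thesis using i(2) by blast
    next
      case True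
      have Delta_output: "inv\<^bsub>G\<^esub> \<Delta> \<in> outputs"
        by (simp add: outputs_def letter_outputs_def)
      from True have "i = 0" "h \<Delta> = t" using i(1) root by auto
      then have "(1, [], spell (inv\<^bsub>G\<^esub> \<Delta>), i) \<in> rewriter"
        using True Delta_output by (intro rewriterI) auto
      from run_step[OF this i(2)] show ?thesis by auto
    qed
  qed
  then obtain v where v: "run rewriter 1 w v 0" by blast
  from run_rewriter_sound[OF v] H.word_val_closed[OF gens_E_closed w]
  have vA: "v \<in> words A" and "shift (word_val G v) = shift k" using k(2) by auto
  note vC = G.word_val_closed[OF A_closed vA]
  have "h (word_val G v) = h k"
    using \<open>shift (word_val G v) = shift k\<close> vC kC by simp
  from kernel_h[OF vC kC this] obtain n where n: "n \<in> generate G D" "k = word_val G v \<otimes>\<^bsub>G\<^esub> n" by blast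
  from run_rewriter_kernel[OF n(1)] obtain u where u: "run rewriter 0 [] u 0" "word_val G u = n" by blast
  have "run rewriter 1 w (v @ u) 0" using run_append[OF v u(1)] by simp
  moreover have "v @ u \<in> words A" "word_val G (v @ u) = k"
    using vA run_rewriter_sound[OF u(1)] G.word_val_append[OF A_closed vA, of u] u(2) n(2) by auto
  ultimately show "w \<in> inverse_transduct rewriter 1 0 (preimage_lang G A K)"
    using k(1) unfolding inverse_transduct_def preimage_lang_def by blast
qed

end

context root_extension
begin

lemma shift_Rec:
  assumes "K \<in> Rec_sets G"
  shows "shift ` K \<in> Rec_sets E"
proof -
  from assms obtain A where K: "K \<subseteq> carrier G" "finite_gen_set G A" "rational (preimage_lang G A K)"
    by (auto simp: Rec_sets_def)
  interpret generated_root_extension G E h \<phi> t p \<Delta> D A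
    by unfold_locales (rule K(2))
  have "rational (preimage_lang E gens_E (shift ` K))"
    unfolding preimage_shift[OF K(1)] by (rule rational_inverse_transduct[OF K(3) finite_rewriter])
  then show ?thesis
    unfolding Rec_sets_def using finite_gen_set_E K(1) by auto
qed

lemma shift_CF:
  assumes "K \<in> CF_sets G"
  shows "shift ` K \<in> CF_sets E"
proof -
  from assms obtain A where K: "K \<subseteq> carrier G" "finite_gen_set G A" "context_free (preimage_lang G A K)"
    by (auto simp: CF_sets_def)
  interpret generated_root_extension G E h \<phi> t p \<Delta> D A
    by unfold_locales (rule K(2))
  have "context_free (preimage_lang E gens_E (shift ` K))"
    unfolding preimage_shift[OF K(1)] by (rule context_free_inverse_transduct[OF K(3) finite_rewriter])
  then show ?thesis
    unfolding CF_sets_def using finite_gen_set_E K(1) by auto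
qed

lemma shift_in_class: "K \<in> sets_in_class \<K> G \<Longrightarrow> shift ` K \<in> sets_in_class \<K> E"
  by (cases \<K>) (auto intro: shift_Fin shift_Coset shift_Rec shift_CF)

lemma sets_in_class_subset: "K \<in> sets_in_class \<K> G \<Longrightarrow> K \<subseteq> carrier G"
proof (cases \<K>)
  case Coset
  moreover assume "K \<in> sets_in_class \<K> G"
  ultimately obtain S g where "S \<subseteq> carrier G" "g \<in> carrier G"
    "K = generate G S #>\<^bsub>G\<^esub> g \<or> K = g <#\<^bsub>G\<^esub> generate G S"
    by (auto simp: Coset_sets_def)
  then show ?thesis
    using G.r_coset_subset_G G.l_coset_subset_G G.generate_incl by metis
qed (auto simp: Fin_sets_def Rec_sets_def CF_sets_def)

theorem twisted_conjugacy_separable_if: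
  assumes "gen_conjugacy_separable \<K> E"
  shows "gen_twisted_conjugacy_separable \<K> G \<phi>"
  unfolding gen_twisted_conjugacy_separable_def twisted_closure_def[symmetric]
proof
  fix K assume K: "K \<in> sets_in_class \<K> G"
  then have "separable E (conj_closure (shift ` K))"
    using assms shift_in_class unfolding gen_conjugacy_separable_def conj_closure_def by blast
  then show "separable G (twisted_closure K)"
    by (rule separable_twisted_closure[OF sets_in_class_subset[OF K]])
qed

end


section \<open>The displacements of \<open>\<Delta>\<close>\<close>

text \<open>Throughout, \<open>\<phi>\<close> is an automorphism and \<open>\<phi>\<^sup>p\<close> is conjugation by \<open>\<Delta>\<close>. The elements
  \<open>\<phi>\<^sup>i(\<Delta>) \<Delta>\<^sup>-\<^sup>1\<close> measure how far \<open>\<Delta>\<close> is from being fixed by \<open>\<phi>\<close>; adjoining a root of \<open>\<Delta>\<close> that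
  induces \<open>\<phi>\<close> makes them trivial.\<close>

locale via_inner = auto: group_endo G \<phi> for G :: "('g, 'm) monoid_scheme" (structure) and \<phi> +
  fixes p :: nat and \<Delta> :: 'g
  assumes bij_phi: "bij_betw \<phi> (carrier G) (carrier G)"
    and p_pos: "p > 0"
    and inner: "inner_by G \<Delta> (\<phi> ^^ p)"
begin

lemma Delta_closed [simp]: "\<Delta> \<in> carrier G"
  using inner by (simp add: inner_by_def)

lemma funpow_p: "x \<in> carrier G \<Longrightarrow> (\<phi> ^^ p) x = inv \<Delta> \<otimes> x \<otimes> \<Delta>"
  using inner by (simp add: inner_by_def)

lemma funpow_Delta: "(\<phi> ^^ p) \<Delta> = \<Delta>"
  by (simp add: funpow_p)

lemma funpow_mult: "x \<in> carrier G \<Longrightarrow> y \<in> carrier G \<Longrightarrow> (\<phi> ^^ i) (x \<otimes> y) = (\<phi> ^^ i) x \<otimes> (\<phi> ^^ i) y"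
  by (induction i) auto

lemma funpow_inv: "x \<in> carrier G \<Longrightarrow> (\<phi> ^^ i) (inv x) = inv ((\<phi> ^^ i) x)"
  by (induction i) auto

lemma funpow_one [simp]: "(\<phi> ^^ i) \<one> = \<one>"
  by (induction i) auto

lemma funpow_surj: "x \<in> carrier G \<Longrightarrow> \<exists>y\<in>carrier G. (\<phi> ^^ i) y = x"
proof (induction i arbitrary: x)
  case (Suc i)
  have "x \<in> \<phi> ` carrier G"
    using bij_phi Suc.prems by (simp add: bij_betw_def)
  then obtain z where z: "z \<in> carrier G" "\<phi> z = x"
    by blast
  with Suc.IH[OF z(1)] show ?case by auto
qed auto

definition disp :: "nat \<Rightarrow> 'g" where
  "disp i = (\<phi> ^^ i) \<Delta> \<otimes> inv \<Delta>"

lemma disp_closed [simp]: "disp i \<in> carrier G"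
  by (simp add: disp_def)

lemma disp_0 [simp]: "disp 0 = \<one>"
  by (simp add: disp_def)

lemma disp_Delta: "disp i \<otimes> \<Delta> = (\<phi> ^^ i) \<Delta>"
  by (simp add: disp_def auto.G.m_assoc)

lemma disp_Suc: "disp (Suc i) = \<phi> (disp i) \<otimes> disp 1"
  by (simp add: disp_def auto.G.m_assoc)

text \<open>\<open>\<phi>\<^sup>i\<close> commutes with \<open>\<phi>\<^sup>p\<close>, so \<open>\<phi>\<^sup>i(\<Delta>)\<close> and \<open>\<Delta>\<close> induce the same inner automorphism.\<close>

lemma disp_central:
  assumes "x \<in> carrier G"
  shows "disp i \<otimes> x = x \<otimes> disp i"
proof -
  let ?a = "(\<phi> ^^ i) \<Delta>"
  obtain y where y: "y \<in> carrier G" "(\<phi> ^^ i) y = x" using funpow_surj[OF assms] by blast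
  have "(\<phi> ^^ i) ((\<phi> ^^ p) y) = (\<phi> ^^ p) ((\<phi> ^^ i) y)"
    using funpow_add[of i p \<phi>] funpow_add[of p i \<phi>] by (simp add: add.commute fun_eq_iff)
  then have "inv ?a \<otimes> x \<otimes> ?a = inv \<Delta> \<otimes> x \<otimes> \<Delta>"
    using y assms by (simp add: funpow_p funpow_mult funpow_inv)
  then have "?a \<otimes> (inv ?a \<otimes> x \<otimes> ?a) \<otimes> inv \<Delta> = ?a \<otimes> (inv \<Delta> \<otimes> x \<otimes> \<Delta>) \<otimes> inv \<Delta>" by simp
  then show ?thesis using assms by (simp add: disp_def auto.G.m_assoc)
qed

definition disps :: "'g set" where
  "disps = disp ` {..<p}"

lemma finite_disps: "finite disps" and disps_closed: "disps \<subseteq> carrier G"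
  by (auto simp: disps_def)

text \<open>As \<open>\<phi>\<^sup>p\<close> fixes \<open>\<Delta>\<close>, the displacements are periodic and the finitely many in
  \<^const>\<open>disps\<close> are all of them.\<close>

lemma disp_mem: "disp i \<in> disps"
proof -
  have "disp (i mod p) = disp i"
    using funpow_mod_eq[OF funpow_Delta, of i] by (simp add: disp_def)
  moreover have "disp (i mod p) \<in> disps" using p_pos by (simp add: disps_def)
  ultimately show ?thesis by simp
qed

abbreviation N :: "'g set" where "N \<equiv> generate G disps"

lemma N_closed: "n \<in> N \<Longrightarrow> n \<in> carrier G"
  by (rule auto.G.generate_in_carrier[OF disps_closed])

lemma disp_in_N: "disp i \<in> N"
  by (rule generate.incl[OF disp_mem])

lemma N_central: "n \<in> N \<Longrightarrow> x \<in> carrier G \<Longrightarrow> n \<otimes> x = x \<otimes> n"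
proof (induction arbitrary: x rule: generate.induct)
  case (incl n)
  then show ?case by (auto simp: disps_def disp_central)
next
  case (inv n)
  then have "n \<in> carrier G" "n \<otimes> x = x \<otimes> n" using disps_closed by (auto simp: disps_def disp_central)
  with inv show ?case by (metis auto.G.inv_closed auto.G.inv_solve_left auto.G.inv_solve_right auto.G.m_assoc auto.G.m_closed)
next
  case (eng m n)
  have mn: "m \<in> carrier G" "n \<in> carrier G" using eng.hyps N_closed by auto
  have "m \<otimes> n \<otimes> x = m \<otimes> (x \<otimes> n)"
    using mn eng.prems by (simp add: auto.G.m_assoc eng.IH(2)[OF eng.prems])
  also have "\<dots> = (x \<otimes> m) \<otimes> n"
    unfolding eng.IH(1)[OF eng.prems, symmetric] using mn eng.prems by (simp add: auto.G.m_assoc)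
  also have "\<dots> = x \<otimes> (m \<otimes> n)" using mn eng.prems by (simp add: auto.G.m_assoc)
  finally show ?case .
qed simp

lemma phi_N: "n \<in> N \<Longrightarrow> \<phi> n \<in> N"
proof -
  assume n: "n \<in> N"
  have "\<phi> (disp i) \<in> N" for i
  proof -
    have "\<phi> (disp i) = disp (Suc i) \<otimes> inv (disp 1)"
      by (simp add: disp_def auto.G.m_assoc auto.G.inv_mult_group)
    then show ?thesis
      using generate.eng[OF disp_in_N generate.inv[OF disp_mem]] by metis
  qed
  then have "\<phi> ` disps \<subseteq> N" by (auto simp: disps_def)
  then have "generate G (\<phi> ` disps) \<subseteq> N"
    by (rule auto.G.generate_subgroup_incl) (rule auto.G.generate_is_subgroup[OF disps_closed])
  then show ?thesis using n auto.generate_img[OF disps_closed] by blast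
qed

lemma funpow_N: "n \<in> N \<Longrightarrow> (\<phi> ^^ i) n \<in> N"
  by (induction i) (auto intro: phi_N)

abbreviation phi_inv :: "'g \<Rightarrow> 'g" where
  "phi_inv \<equiv> inv_into (carrier G) \<phi>"

lemma phi_inv_closed [simp]: "x \<in> carrier G \<Longrightarrow> phi_inv x \<in> carrier G"
  using bij_phi by (metis bij_betw_def inv_into_into)

lemma phi_phi_inv [simp]: "x \<in> carrier G \<Longrightarrow> \<phi> (phi_inv x) = x"
  using bij_phi by (simp add: bij_betw_def f_inv_into_f)

lemma phi_inv_phi [simp]: "x \<in> carrier G \<Longrightarrow> phi_inv (\<phi> x) = x"
  using bij_phi by (simp add: bij_betw_def)

lemma phi_inv_mult:
  "x \<in> carrier G \<Longrightarrow> y \<in> carrier G \<Longrightarrow> phi_inv (x \<otimes> y) = phi_inv x \<otimes> phi_inv y"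
  using phi_inv_phi[of "phi_inv x \<otimes> phi_inv y"] by simp

text \<open>On the centre \<open>\<phi>\<^sup>p\<close> is the identity, so \<open>\<phi>\<^sup>-\<^sup>1\<close> agrees there with \<open>\<phi>\<close> iterated
  \<open>p - 1\<close> times.\<close>

lemma phi_inv_N: "n \<in> N \<Longrightarrow> phi_inv n \<in> N"
proof -
  assume n: "n \<in> N"
  have "\<phi> ((\<phi> ^^ (p - 1)) n) = (\<phi> ^^ p) n"
    using p_pos by (cases p) auto
  also have "\<dots> = n"
    using n N_central[OF n, of "inv \<Delta>"] N_closed[OF n] by (simp add: funpow_p auto.G.m_assoc flip: N_central[OF n])
  finally have "phi_inv n = (\<phi> ^^ (p - 1)) n"
    using N_closed[OF n] phi_inv_phi[of "(\<phi> ^^ (p - 1)) n"] by simp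
  then show ?thesis using funpow_N[OF n] by simp
qed

text \<open>This is why the collapse of the displacements in \<open>G\<^sup>\<phi>\<close> does no harm: a twisted conjugacy class
  is a union of cosets of the subgroup that they generate.\<close>

lemma twisted_conj_disp: "s \<in> carrier G \<Longrightarrow> twisted_conj G \<phi> s (s \<otimes> disp i)"
proof (induction i arbitrary: s)
  case 0
  then show ?case by (simp add: auto.twisted_conj_refl)
next
  case (Suc i)
  \<comment> \<open>Twisted conjugation by \<open>\<Delta>\<close> sends \<open>y\<close> to \<open>disp 1\<^sup>-\<^sup>1 \<phi>\<^sup>p(y)\<close>, and \<open>\<phi>\<^sup>p(y)\<close> is again in the class of \<open>y\<close>;
    \<open>y\<close> is chosen so that these two elements are \<open>s\<close> and \<open>s disp 1\<close>.\<close>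
  have one: "twisted_conj G \<phi> s (s \<otimes> disp 1)" if s: "s \<in> carrier G" for s
  proof -
    obtain y where y: "y \<in> carrier G" "(\<phi> ^^ p) y = s \<otimes> disp 1"
      using funpow_surj[of "s \<otimes> disp 1" p] s by auto
    have "\<phi> \<Delta> = \<Delta> \<otimes> disp 1"
      using disp_Delta[of 1] disp_central[of \<Delta> 1] by simp
    then have "\<phi> (inv \<Delta>) = inv (disp 1) \<otimes> inv \<Delta>"
      by (simp add: auto.G.inv_mult_group)
    then have "\<phi> (inv \<Delta>) \<otimes> y \<otimes> \<Delta> = inv (disp 1) \<otimes> (inv \<Delta> \<otimes> y \<otimes> \<Delta>)"
      using y(1) by (simp add: auto.G.m_assoc)
    also have "\<dots> = inv (disp 1) \<otimes> (disp 1 \<otimes> s)"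
      using y(2) disp_central[OF s, of 1] by (simp only: funpow_p[OF y(1)])
    finally have "\<phi> (inv \<Delta>) \<otimes> y \<otimes> \<Delta> = s" using s by simp
    then have "twisted_conj G \<phi> y s"
      using auto.twisted_conjI[OF y(1) Delta_closed] by simp
    moreover have "twisted_conj G \<phi> y (s \<otimes> disp 1)"
      using auto.twisted_conj_funpow[OF y(1), of p] y(2) by simp
    ultimately show ?thesis
      using auto.twisted_conj_sym auto.twisted_conj_trans by blast
  qed
  \<comment> \<open>The general case: \<open>disp (i + 1) = \<phi>(disp i) disp 1\<close>, and applying \<open>\<phi>\<close> stays inside a class.\<close>
  obtain y where y: "y \<in> carrier G" "\<phi> y = s"
    using funpow_surj[OF Suc.prems, of 1] by auto
  have "twisted_conj G \<phi> s y"
    using auto.twisted_conj_sym[OF auto.twisted_conj_endo[OF y(1)]] y(2) by simp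
  also note Suc.IH[OF y(1)]
  also have "twisted_conj G \<phi> (y \<otimes> disp i) (\<phi> (y \<otimes> disp i))"
    using y by (intro auto.twisted_conj_endo) simp
  also have "twisted_conj G \<phi> (\<phi> (y \<otimes> disp i)) (\<phi> (y \<otimes> disp i) \<otimes> disp 1)"
    using y Suc.prems by (intro one) simp
  also have "\<phi> (y \<otimes> disp i) \<otimes> disp 1 = s \<otimes> disp (Suc i)"
    using y(1) Suc.prems by (simp only: auto.hom_mult disp_closed y(2) disp_Suc auto.G.m_assoc auto.hom_closed)
  finally show ?case .
qed

lemma twisted_conj_N: "n \<in> N \<Longrightarrow> s \<in> carrier G \<Longrightarrow> twisted_conj G \<phi> s (s \<otimes> n)"
proof (induction arbitrary: s rule: generate.induct)
  case one
  then show ?case by (simp add: auto.twisted_conj_refl)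
next
  case (incl n)
  then show ?case by (auto simp: disps_def twisted_conj_disp)
next
  case (inv n)
  then obtain i where i: "n = disp i" by (auto simp: disps_def)
  have "twisted_conj G \<phi> (s \<otimes> inv n) (s \<otimes> inv n \<otimes> n)"
    unfolding i using inv.prems by (intro twisted_conj_disp) simp
  moreover have "s \<otimes> inv n \<otimes> n = s" using inv.prems i by (simp add: auto.G.m_assoc)
  ultimately show ?case using auto.twisted_conj_sym by simp
next
  case (eng m n)
  have mn: "m \<in> carrier G" "n \<in> carrier G" using eng.hyps N_closed by auto
  have "twisted_conj G \<phi> s (s \<otimes> m)"
    by (rule eng.IH(1)[OF eng.prems])
  also have "twisted_conj G \<phi> (s \<otimes> m) (s \<otimes> m \<otimes> n)"
    using mn eng.prems by (intro eng.IH) simp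
  also have "s \<otimes> m \<otimes> n = s \<otimes> (m \<otimes> n)"
    using mn eng.prems by (simp add: auto.G.m_assoc)
  finally show ?case .
qed

end


section \<open>The group presented by adjoining the root\<close>

locale via_presentation = via_inner G \<phi> p \<Delta>
  for G :: "('g, 'm) monoid_scheme" (structure) and \<phi> p \<Delta> +
  fixes A :: "'x set" and R :: "('x word \<times> 'x word) set" and f :: "'x word set \<Rightarrow> 'g"
  assumes iso_f: "f \<in> iso (presented_group A R) G"
begin

definition val :: "'x word \<Rightarrow> 'g" where
  "val w = f (word_class A R w)"

lemma word_class_carrier: "w \<in> words A \<Longrightarrow> word_class A R w \<in> carrier (presented_group A R)"
  by (simp add: presented_group_def)

lemma val_closed [simp]: "w \<in> words A \<Longrightarrow> val w \<in> carrier G"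
  using iso_f word_class_carrier unfolding val_def iso_def hom_def by blast

lemma val_append: "u \<in> words A \<Longrightarrow> v \<in> words A \<Longrightarrow> val (u @ v) = val u \<otimes> val v"
  using hom_mult[of f "presented_group A R" G "word_class A R u" "word_class A R v"] iso_f
  by (simp add: iso_def val_def mult_presented_group word_class_carrier auto.G.is_group group_presented_group)

lemma val_Nil [simp]: "val [] = \<one>"
  using hom_one[of f "presented_group A R" G] iso_f group_presented_group[of A R] auto.G.is_group
  by (simp add: iso_def val_def presented_group_def)

lemma val_surj: "g \<in> carrier G \<Longrightarrow> \<exists>w\<in>words A. val w = g"
proof -
  assume "g \<in> carrier G"
  then have "g \<in> f ` carrier (presented_group A R)"
    using iso_f unfolding iso_def bij_betw_def by blast
  then show ?thesis by (auto simp: val_def presented_group_def)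
qed

lemma val_eq_iff: "u \<in> words A \<Longrightarrow> v \<in> words A \<Longrightarrow> val u = val v \<longleftrightarrow> pres_eq A R u v"
  using iso_f word_class_carrier unfolding iso_def bij_betw_def val_def
  by (auto simp: inj_on_eq_iff word_class_eq_iff)

lemma val_letter_mult: "a \<in> A \<Longrightarrow> val [(a, b)] \<otimes> val [(a, \<not> b)] = \<one>"
  using val_append[of "[(a, b)]" "[(a, \<not> b)]"] val_eq_iff[of "[(a, b), (a, \<not> b)]" "[]"]
  by (simp add: pres_eq_cancel)

lemma val_letter_inv: "a \<in> A \<Longrightarrow> val [(a, False)] = inv (val [(a, True)])"
  using val_letter_mult[of a False] auto.G.inv_equality[of "val [(a, False)]" "val [(a, True)]"] by simp

abbreviation "A_t \<equiv> insert None (Some ` A)"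

text \<open>The defining relations of \<open>G\<^sup>\<phi>\<close>, with the spelling condition phrased through \<^const>\<open>val\<close>.\<close>

definition R_t :: "('x option word \<times> 'x option word) set" where
  "R_t = map_prod lift_word lift_word ` R \<union>
      {([(None, False), (Some a, True), (None, True)], lift_word w) | a w.
         a \<in> A \<and> w \<in> words A \<and> val w = \<phi> (val [(a, True)])} \<union>
      {(replicate p (None, True), lift_word w) | w. w \<in> words A \<and> val w = \<Delta>}"

abbreviation "E \<equiv> presented_group A_t R_t"

lemma G_phi_eq: "G_phi A R f \<phi> p \<Delta> = E"
  unfolding G_phi_def R_t_def val_def ..

lemma lift_word_simps [simp]:
  "lift_word [] = []" "lift_word ((a, b) # w) = (Some a, b) # lift_word w"
  "lift_word (u @ v) = lift_word u @ lift_word v"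
  by (simp_all add: lift_word_def)

lemma lift_word_words [simp]: "w \<in> words A \<Longrightarrow> lift_word w \<in> words A_t"
  by (induction w) (auto simp: lift_word_def)

lemma replicate_words [simp]: "replicate i (None, b) \<in> words A_t"
  by (induction i) auto

lemma pres_eq_lift: "pres_eq A R u v \<Longrightarrow> pres_eq A_t R_t (lift_word u) (lift_word v)"
proof (induction rule: pres_eq.induct)
  case (pres_eq_rel u v)
  then show ?case
    by (intro pres_eq.pres_eq_rel) (auto simp: R_t_def)
qed (auto intro: pres_eq.intros)

abbreviation cl :: "'x option word \<Rightarrow> 'x option word set" where
  "cl \<equiv> word_class A_t R_t"

lemma cl_closed [simp]: "w \<in> words A_t \<Longrightarrow> cl w \<in> carrier E"
  by (simp add: presented_group_def)

lemma cl_append: "u \<in> words A_t \<Longrightarrow> v \<in> words A_t \<Longrightarrow> cl (u @ v) = cl u \<otimes>\<^bsub>E\<^esub> cl v"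
  by (simp add: mult_presented_group)

lemma cl_Nil: "cl [] = \<one>\<^bsub>E\<^esub>"
  by (simp add: presented_group_def)

definition root_t :: "'x option word set" where
  "root_t = cl [(None, True)]"

definition embed :: "'g \<Rightarrow> 'x option word set" where
  "embed g = cl (lift_word (SOME w. w \<in> words A \<and> val w = g))"

lemma embed_val: "w \<in> words A \<Longrightarrow> embed (val w) = cl (lift_word w)"
proof -
  assume w: "w \<in> words A"
  define v where "v = (SOME v. v \<in> words A \<and> val v = val w)"
  have v: "v \<in> words A \<and> val v = val w"
    unfolding v_def by (rule someI[of _ w]) (use w in simp)
  then have "pres_eq A_t R_t (lift_word v) (lift_word w)"
    using w val_eq_iff[of v w] by (intro pres_eq_lift) simp
  then show ?thesis
    using v by (simp add: embed_def word_class_eq_iff flip: v_def)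
qed

sublocale E: group E
  by (rule group_presented_group)

lemma root_t_closed [simp]: "root_t \<in> carrier E"
  by (simp add: root_t_def)

sublocale embed: group_hom G E embed
proof unfold_locales
  have "embed g \<in> carrier E \<and> embed (g \<otimes> g') = embed g \<otimes>\<^bsub>E\<^esub> embed g'"
    if "g \<in> carrier G" "g' \<in> carrier G" for g g'
  proof -
    from that val_surj obtain w w' where "w \<in> words A" "val w = g" "w' \<in> words A" "val w' = g'"
      by metis
    then show ?thesis
      using embed_val[of w] embed_val[of w'] embed_val[of "w @ w'"] by (auto simp: val_append cl_append)
  qed
  then show "embed \<in> hom G E" by (auto simp: hom_def)
qed

lemma cl_pow: "cl (replicate i (None, True)) = root_t [^]\<^bsub>E\<^esub> i"
proof (induction i)
  case (Suc i)
  have "cl (replicate (Suc i) (None, True)) = cl (replicate i (None, True) @ [(None, True)])"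
    by (simp add: replicate_append_same)
  then show ?case using Suc by (simp add: cl_append root_t_def)
qed (simp add: cl_Nil)

lemma root_pow: "root_t [^]\<^bsub>E\<^esub> p = embed \<Delta>"
proof -
  from val_surj[OF Delta_closed] obtain w where w: "w \<in> words A" "val w = \<Delta>" by blast
  have "pres_eq A_t R_t (replicate p (None, True)) (lift_word w)"
    using w by (intro pres_eq_rel) (auto simp: R_t_def)
  then show ?thesis
    using w embed_val[OF w(1)] by (simp add: word_class_eq_iff flip: cl_pow)
qed

lemma cl_t_inv: "cl [(None, False)] = inv\<^bsub>E\<^esub> root_t"
proof -
  have "pres_eq A_t R_t [(None, False), (None, True)] []"
    using pres_eq_cancel[of None A_t R_t False] by simp
  then have "cl [(None, False)] \<otimes>\<^bsub>E\<^esub> root_t = \<one>\<^bsub>E\<^esub>"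
    unfolding root_t_def
    by (simp add: word_class_eq_iff mult_presented_group flip: cl_Nil)
  then show ?thesis by (intro E.inv_equality[symmetric]) simp_all
qed

lemma embed_conj_letter:
  assumes "a \<in> A"
  shows "embed (val [(a, True)]) \<otimes>\<^bsub>E\<^esub> root_t = root_t \<otimes>\<^bsub>E\<^esub> embed (\<phi> (val [(a, True)]))"
proof -
  have "\<phi> (val [(a, True)]) \<in> carrier G" using assms by simp
  from val_surj[OF this] obtain w where w: "w \<in> words A" "val w = \<phi> (val [(a, True)])" by blast
  have "pres_eq A_t R_t [(None, False), (Some a, True), (None, True)] (lift_word w)"
    using w assms by (intro pres_eq_rel) (auto simp: R_t_def)
  then have "embed (val w) = cl ([(None, False)] @ [(Some a, True)] @ [(None, True)])"
    using w(1) assms by (simp add: embed_val word_class_eq_iff pres_eq_sym)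
  also have "\<dots> = inv\<^bsub>E\<^esub> root_t \<otimes>\<^bsub>E\<^esub> (embed (val [(a, True)]) \<otimes>\<^bsub>E\<^esub> root_t)"
    using assms embed_val[of "[(a, True)]"] cl_append[of "[(None, False)]" "[(Some a, True)] @ [(None, True)]"]
      cl_append[of "[(Some a, True)]" "[(None, True)]"]
    by (simp add: cl_t_inv flip: root_t_def)
  finally show ?thesis
    using assms unfolding w(2) by simp
qed

lemma embed_conj:
  assumes "g \<in> carrier G"
  shows "embed g \<otimes>\<^bsub>E\<^esub> root_t = root_t \<otimes>\<^bsub>E\<^esub> embed (\<phi> g)"
proof -
  from val_surj[OF assms] obtain w where "w \<in> words A" "val w = g" by blast
  then show ?thesis
  proof (induction w arbitrary: g)
    case (Cons l w)
    obtain a b where l: "l = (a, b)" by force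
    have a: "a \<in> A" and w: "w \<in> words A" using Cons.prems l by auto
    have g: "g = val [(a, b)] \<otimes> val w"
      using Cons.prems val_append[of "[(a, b)]" w] l by simp
    have letter: "embed (val [(a, b)]) \<otimes>\<^bsub>E\<^esub> root_t = root_t \<otimes>\<^bsub>E\<^esub> embed (\<phi> (val [(a, b)]))"
    proof (cases b)
      case True
      then show ?thesis using embed_conj_letter[OF a] by simp
    next
      case False
      let ?x = "val [(a, True)]"
      have x: "?x \<in> carrier G" using a by simp
      have "inv\<^bsub>E\<^esub> (embed ?x) \<otimes>\<^bsub>E\<^esub> (embed ?x \<otimes>\<^bsub>E\<^esub> root_t) \<otimes>\<^bsub>E\<^esub> inv\<^bsub>E\<^esub> (embed (\<phi> ?x)) =
          inv\<^bsub>E\<^esub> (embed ?x) \<otimes>\<^bsub>E\<^esub> (root_t \<otimes>\<^bsub>E\<^esub> embed (\<phi> ?x)) \<otimes>\<^bsub>E\<^esub> inv\<^bsub>E\<^esub> (embed (\<phi> ?x))"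
        unfolding embed_conj_letter[OF a] ..
      then show ?thesis
        using False a x by (simp add: val_letter_inv E.m_assoc)
    qed
    have vC: "val [(a, b)] \<in> carrier G" "val w \<in> carrier G" using a w by auto
    have "embed g \<otimes>\<^bsub>E\<^esub> root_t = embed (val [(a, b)]) \<otimes>\<^bsub>E\<^esub> (embed (val w) \<otimes>\<^bsub>E\<^esub> root_t)"
      unfolding g using vC by (simp add: E.m_assoc)
    also have "\<dots> = (embed (val [(a, b)]) \<otimes>\<^bsub>E\<^esub> root_t) \<otimes>\<^bsub>E\<^esub> embed (\<phi> (val w))"
      using Cons.IH[OF w refl] vC by (simp add: E.m_assoc)
    also have "\<dots> = root_t \<otimes>\<^bsub>E\<^esub> embed (\<phi> g)"
      unfolding letter g using vC by (simp add: E.m_assoc)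
    finally show ?case .
  qed auto
qed

lemma embed_generated: "generate E (insert root_t (embed ` carrier G)) = carrier E"
proof
  let ?S = "insert root_t (embed ` carrier G)"
  have "?S \<subseteq> carrier E" by auto
  then show "generate E ?S \<subseteq> carrier E" by (rule E.generate_incl)
  have "cl w \<in> generate E ?S" if "w \<in> words A_t" for w
    using that
  proof (induction w)
    case Nil
    then show ?case by (simp add: cl_Nil generate.one)
  next
    case (Cons l w)
    obtain c b where l: "l = (c, b)" by force
    have "cl [l] \<in> generate E ?S"
    proof (cases c)
      case None
      then show ?thesis
        using l cl_t_inv generate.incl[of root_t ?S E] generate.inv[of root_t ?S E]
        by (cases b) (auto simp: root_t_def)
    next
      case (Some a)
      then have "a \<in> A" using Cons.prems l by auto
      then have "cl [l] \<in> embed ` carrier G"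
        using embed_val[of "[(a, b)]"] l Some by (auto intro!: image_eqI[of _ _ "val [(a, b)]"])
      then show ?thesis by (auto intro: generate.incl)
    qed
    then have "cl [l] \<otimes>\<^bsub>E\<^esub> cl w \<in> generate E ?S"
      using Cons by (intro generate.eng) auto
    then show ?case
      using cl_append[of "[l]" w] Cons.prems by simp
  qed
  then show "carrier E \<subseteq> generate E ?S"
    by (auto simp: presented_group_def)
qed

text \<open>\<open>\<Delta>\<close> becomes a power of \<open>t\<close>, so conjugation by \<open>t\<close>, which induces \<open>\<phi>\<close>, fixes it.\<close>

lemma embed_disp:
  assumes "d \<in> disps"
  shows "embed d = \<one>\<^bsub>E\<^esub>"
proof -
  have "embed ((\<phi> ^^ i) \<Delta>) = embed \<Delta>" for i
  proof (induction i)
    case (Suc i)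
    have "embed \<Delta> \<otimes>\<^bsub>E\<^esub> root_t = root_t \<otimes>\<^bsub>E\<^esub> embed \<Delta>"
      unfolding root_pow[symmetric] by (rule E.nat_pow_comm[of root_t p 1, simplified])
    moreover have "embed \<Delta> \<otimes>\<^bsub>E\<^esub> root_t = root_t \<otimes>\<^bsub>E\<^esub> embed ((\<phi> ^^ Suc i) \<Delta>)"
      using embed_conj[of "(\<phi> ^^ i) \<Delta>"] Suc by simp
    ultimately show ?case by simp
  qed simp
  with assms show ?thesis by (auto simp: disps_def disp_def)
qed

text \<open>To bound the kernel of \<^const>\<open>embed\<close> from above, words over the generators of \<open>G\<^sup>\<phi>\<close> act on the
  pairs \<open>(i, g)\<close> with \<open>i < p\<close>, which stand for \<open>t\<^sup>i g\<close>, by multiplication on the right: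
  \<open>t\<^sup>i g a = t\<^sup>i (g a)\<close> and \<open>t\<^sup>i g t = t\<^sup>i\<^sup>+\<^sup>1 \<phi>(g)\<close>, where \<open>t\<^sup>p\<close> is replaced by \<open>\<Delta>\<close>. In this order only \<open>\<phi>\<close>
  itself and, for \<open>t\<^sup>-\<^sup>1\<close>, its inverse occur.\<close>

fun act_letter :: "'x option \<times> bool \<Rightarrow> nat \<times> 'g \<Rightarrow> nat \<times> 'g" where
  "act_letter (Some a, b) (i, g) = (i, g \<otimes> val [(a, b)])"
| "act_letter (None, True) (i, g) = (if Suc i = p then (0, \<Delta> \<otimes> \<phi> g) else (Suc i, \<phi> g))"
| "act_letter (None, False) (i, g) =
     (if i = 0 then (p - 1, phi_inv (inv \<Delta> \<otimes> g)) else (i - 1, phi_inv g))"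

abbreviation act :: "'x option word \<Rightarrow> nat \<times> 'g \<Rightarrow> nat \<times> 'g" where
  "act \<equiv> fold act_letter"

abbreviation points :: "(nat \<times> 'g) set" where
  "points \<equiv> {..<p} \<times> carrier G"

text \<open>The relation \<open>t\<^sup>p = \<Delta>\<close> holds for this action only modulo the displacements.\<close>

definition similar :: "nat \<times> 'g \<Rightarrow> nat \<times> 'g \<Rightarrow> bool" where
  "similar x y \<longleftrightarrow> fst x = fst y \<and> (\<exists>n\<in>N. snd y = snd x \<otimes> n)"

lemma similar_refl: "x \<in> points \<Longrightarrow> similar x x"
  unfolding similar_def using generate.one[of G disps] by (auto intro!: bexI[of _ \<one>])

lemma similar_sym:
  assumes "similar x y" "x \<in> points"
  shows "similar y x"
proof -
  from assms obtain n where n: "n \<in> N" "fst x = fst y" "snd y = snd x \<otimes> n"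
    by (auto simp: similar_def)
  then have "inv n \<in> N" "snd x = snd y \<otimes> inv n"
    using assms(2) N_closed[OF n(1)] auto.G.generate_m_inv_closed[OF disps_closed n(1)]
    by (auto simp: auto.G.m_assoc)
  with n(2) show ?thesis unfolding similar_def by metis
qed

lemma similar_trans:
  assumes "similar x y" "similar y z" "x \<in> points"
  shows "similar x z"
proof -
  from assms obtain m n where mn: "m \<in> N" "n \<in> N" "fst x = fst z" "snd z = snd x \<otimes> m \<otimes> n"
    by (auto simp: similar_def)
  then have "m \<otimes> n \<in> N" "snd z = snd x \<otimes> (m \<otimes> n)"
    using assms(3) N_closed[OF mn(1)] N_closed[OF mn(2)] generate.eng[OF mn(1,2)]
    by (auto simp: auto.G.m_assoc)
  with mn(3) show ?thesis unfolding similar_def by metis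
qed

lemma act_letter_closed: "x \<in> points \<Longrightarrow> fst l \<in> A_t \<Longrightarrow> act_letter l x \<in> points"
  by (cases "(l, x)" rule: act_letter.cases) auto

lemma act_closed: "w \<in> words A_t \<Longrightarrow> x \<in> points \<Longrightarrow> act w x \<in> points"
proof (induction w arbitrary: x)
  case (Cons l w)
  then show ?case using act_letter_closed[of x l] by simp
qed simp

lemma act_letter_cancel:
  assumes "x \<in> points" "c \<in> A_t"
  shows "act_letter (c, \<not> b) (act_letter (c, b) x) = x"
proof -
  obtain i g where x: "x = (i, g)" "i < p" "g \<in> carrier G" using assms(1) by auto
  show ?thesis
  proof (cases c)
    case None
    then show ?thesis using x p_pos by (cases b) auto
  next
    case (Some a)
    then have "a \<in> A" using assms(2) by auto
    then show ?thesis using x Some val_letter_mult[of a b] by (simp add: auto.G.m_assoc)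
  qed
qed

text \<open>Here the subgroup \<open>N\<close> has to be central, for the letters of \<open>G\<close>, and invariant under \<open>\<phi>\<close> and
  \<open>\<phi>\<^sup>-\<^sup>1\<close>, for the letters \<open>t\<close> and \<open>t\<^sup>-\<^sup>1\<close>.\<close>

lemma act_letter_similar:
  assumes "similar x y" "x \<in> points" "fst l \<in> A_t"
  shows "similar (act_letter l x) (act_letter l y)"
proof -
  from assms obtain i g n where x: "x = (i, g)" "i < p" "g \<in> carrier G" "y = (i, g \<otimes> n)" and n: "n \<in> N"
    by (cases x, cases y) (auto simp: similar_def)
  note nC = N_closed[OF n]
  obtain c b where l: "l = (c, b)" by force
  show ?thesis
  proof (cases c)
    case (Some a)
    then have a: "val [(a, b)] \<in> carrier G" using assms(3) l by auto
    have "g \<otimes> n \<otimes> val [(a, b)] = g \<otimes> val [(a, b)] \<otimes> n"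
      using a x(3) nC N_central[OF n a] by (simp add: auto.G.m_assoc)
    then show ?thesis using n l Some x by (auto simp: similar_def)
  next
    case None
    show ?thesis
    proof (cases b)
      case True
      have "\<phi> n \<in> N" by (rule phi_N[OF n])
      moreover have "\<phi> (g \<otimes> n) = \<phi> g \<otimes> \<phi> n" "\<Delta> \<otimes> \<phi> (g \<otimes> n) = \<Delta> \<otimes> \<phi> g \<otimes> \<phi> n"
        using x(3) nC by (simp_all add: auto.G.m_assoc)
      ultimately show ?thesis
        using True None l x unfolding similar_def by (auto intro!: bexI[of _ "\<phi> n"])
    next
      case False
      have "phi_inv n \<in> N" by (rule phi_inv_N[OF n])
      moreover have "phi_inv (g \<otimes> n) = phi_inv g \<otimes> phi_inv n"
        "phi_inv (inv \<Delta> \<otimes> (g \<otimes> n)) = phi_inv (inv \<Delta> \<otimes> g) \<otimes> phi_inv n"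
        using x(3) nC by (simp_all add: phi_inv_mult auto.G.m_assoc)
      ultimately show ?thesis
        using False None l x unfolding similar_def by (auto intro!: bexI[of _ "phi_inv n"])
    qed
  qed
qed

lemma act_similar:
  "w \<in> words A_t \<Longrightarrow> x \<in> points \<Longrightarrow> similar x y \<Longrightarrow> similar (act w x) (act w y)"
proof (induction w arbitrary: x y)
  case (Cons l w)
  then show ?case
    using act_letter_similar[of x y l] act_letter_closed[of x l] by simp
qed simp

lemma act_lift: "w \<in> words A \<Longrightarrow> g \<in> carrier G \<Longrightarrow> act (lift_word w) (i, g) = (i, g \<otimes> val w)"
proof (induction w arbitrary: g)
  case (Cons l w)
  obtain a b where l: "l = (a, b)" by force
  have "val (l # w) = val [l] \<otimes> val w" using val_append[of "[l]" w] Cons.prems by simp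
  then show ?case using Cons l by (simp add: auto.G.m_assoc)
qed simp

lemma act_replicate_Suc: "act (replicate (Suc k) l) x = act_letter l (act (replicate k l) x)"
  by (simp add: fold_append flip: replicate_append_same)

lemma act_t_pow: "i + k < p \<Longrightarrow> act (replicate k (None, True)) (i, g) = (i + k, (\<phi> ^^ k) g)"
  by (induction k) (simp_all add: act_replicate_Suc del: replicate_Suc)

text \<open>The first coordinate reaches \<open>p\<close> once, after \<open>p - i\<close> steps; the factor \<open>\<Delta>\<close> that appears then is
  moved by the remaining \<open>i\<close> steps.\<close>

lemma act_t_period:
  assumes "i < p" "g \<in> carrier G"
  shows "act (replicate p (None, True)) (i, g) = (i, (\<phi> ^^ i) \<Delta> \<otimes> (inv \<Delta> \<otimes> g \<otimes> \<Delta>))"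
proof -
  let ?k = "p - 1 - i"
  have "replicate p (None :: 'x option, True) = replicate (Suc ?k) (None, True) @ replicate i (None, True)"
    using assms(1) by (simp flip: replicate_add replicate_Suc)
  then have "act (replicate p (None, True)) (i, g) =
      act (replicate i (None, True)) (act_letter (None, True) (act (replicate ?k (None, True)) (i, g)))"
    by (simp only: fold_append o_apply act_replicate_Suc[symmetric])
  also have "\<dots> = act (replicate i (None, True)) (0, \<Delta> \<otimes> (\<phi> ^^ Suc ?k) g)"
    using assms(1) act_t_pow[of i ?k g] by simp
  also have "\<dots> = (i, (\<phi> ^^ i) (\<Delta> \<otimes> (\<phi> ^^ Suc ?k) g))"
    using assms(1) act_t_pow[of 0 i] by simp
  also have "(\<phi> ^^ i) (\<Delta> \<otimes> (\<phi> ^^ Suc ?k) g) = (\<phi> ^^ i) \<Delta> \<otimes> (\<phi> ^^ (i + Suc ?k)) g"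
    using assms(2) auto.funpow_closed[of g "Suc ?k"] by (simp only: funpow_mult Delta_closed funpow_add o_apply)
  also have "i + Suc ?k = p" using assms(1) by simp
  finally show ?thesis using funpow_p[OF assms(2)] by simp
qed

lemma act_relation:
  assumes "(u, v) \<in> R_t" "u \<in> words A_t" "v \<in> words A_t" "x \<in> points"
  shows "similar (act u x) (act v x)"
proof -
  obtain i g where x: "x = (i, g)" "i < p" "g \<in> carrier G" using assms(4) by auto
  from assms(1) show ?thesis
    unfolding R_t_def
  proof (elim UnE, goal_cases)
    case 1
    then obtain u' v' where uv: "(u', v') \<in> R" "u = lift_word u'" "v = lift_word v'" by auto
    have unlift: "lift_word w \<in> words A_t \<Longrightarrow> w \<in> words A" for w :: "'x word"
      by (induction w) (auto simp: lift_word_def)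
    then have "u' \<in> words A" "v' \<in> words A" using assms(2,3) uv by auto
    moreover from this have "val u' = val v'" using val_eq_iff uv(1) pres_eq_rel by metis
    ultimately show ?case
      using x similar_refl[of "(i, g \<otimes> val v')"] by (simp add: uv act_lift)
  next
    case 2
    then obtain a w where a: "a \<in> A" "w \<in> words A" "val w = \<phi> (val [(a, True)])"
      "u = [(None, False), (Some a, True), (None, True)]" "v = lift_word w" by auto
    obtain j k where y: "act_letter (None, False) x = (j, k)" "j < p" "k \<in> carrier G"
      using act_letter_closed[of x "(None, False)"] assms(4) by auto
    \<comment> \<open>Write \<open>x\<close> as \<open>(j, k)\<close> followed by \<open>t\<close>; then \<open>t\<^sup>-\<^sup>1 a t\<close> leads from \<open>x\<close> to \<open>(j, k a)\<close> followed by \<open>t\<close>.\<close>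
    have "act_letter (None, True) (j, k) = x"
      using act_letter_cancel[of x None False] assms(4) y(1) by simp
    then have "act u x = (i, g \<otimes> val w)"
      using y x a by (auto simp: auto.G.m_assoc split: if_splits)
    then show ?case
      using x a similar_refl[of "(i, g \<otimes> val w)"] by (simp add: act_lift)
  next
    case 3
    then obtain w where w: "w \<in> words A" "val w = \<Delta>" "u = replicate p (None, True)" "v = lift_word w"
      by auto
    have "(\<phi> ^^ i) \<Delta> \<otimes> (inv \<Delta> \<otimes> g \<otimes> \<Delta>) = g \<otimes> \<Delta> \<otimes> disp i"
      using x(3) disp_central[of "g \<otimes> \<Delta>" i] by (simp add: disp_def auto.G.m_assoc)
    then have "act u x = (i, g \<otimes> \<Delta> \<otimes> disp i)" "act v x = (i, g \<otimes> \<Delta>)"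
      using x w act_t_period[OF x(2,3)] by (simp_all add: act_lift)
    then have "similar (act v x) (act u x)"
      using disp_in_N[of i] by (auto simp: similar_def)
    then show ?case
      by (rule similar_sym) (rule act_closed[OF assms(3,4)])
  qed
qed

lemma act_pres_eq: "pres_eq A_t R_t u v \<Longrightarrow> x \<in> points \<Longrightarrow> similar (act u x) (act v x)"
proof (induction arbitrary: x rule: pres_eq.induct)
  case (pres_eq_refl w)
  then show ?case by (intro similar_refl act_closed)
next
  case (pres_eq_sym u v)
  show ?case
    by (rule similar_sym[OF pres_eq_sym.IH[OF pres_eq_sym.prems] act_closed[OF _ pres_eq_sym.prems]])
      (use pres_eq_words[OF pres_eq_sym.hyps] in simp)
next
  case (pres_eq_trans u v w)
  have "u \<in> words A_t" using pres_eq_words[OF pres_eq_trans.hyps(1)] by simp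
  then show ?case
    using pres_eq_trans.prems by (intro similar_trans[OF pres_eq_trans.IH(1,2) act_closed])
next
  case (pres_eq_append u u' v v')
  have words: "u \<in> words A_t" "u' \<in> words A_t" "v \<in> words A_t"
    using pres_eq_append.hyps pres_eq_words by blast+
  have u: "act u x \<in> points" "act u' x \<in> points" using words pres_eq_append.prems act_closed by blast+
  have "similar (act v (act u x)) (act v (act u' x))"
    by (intro act_similar words u pres_eq_append.IH pres_eq_append.prems)
  then have "similar (act v (act u x)) (act v' (act u' x))"
    by (rule similar_trans[OF _ pres_eq_append.IH(2)[OF u(2)] act_closed[OF words(3) u(1)]])
  then show ?case by simp
next
  case (pres_eq_cancel a b)
  then show ?case using act_letter_cancel[of x a b] similar_refl by simp
next
  case (pres_eq_rel u v)
  then show ?case by (rule act_relation)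
qed

text \<open>Let both words act on \<open>(0, 1)\<close>.\<close>

lemma embed_normal_form:
  assumes "i < p" "j < p" "g \<in> carrier G" "g' \<in> carrier G"
    and eq: "root_t [^]\<^bsub>E\<^esub> i \<otimes>\<^bsub>E\<^esub> embed g = root_t [^]\<^bsub>E\<^esub> j \<otimes>\<^bsub>E\<^esub> embed g'"
  shows "i = j \<and> (\<exists>n\<in>N. g' = g \<otimes> n)"
proof -
  from val_surj assms(3,4) obtain w w' where w: "w \<in> words A" "val w = g" "w' \<in> words A" "val w' = g'"
    by metis
  let ?u = "replicate i (None, True) @ lift_word w"
  let ?v = "replicate j (None, True) @ lift_word w'"
  have "cl ?u = cl ?v"
    using eq w embed_val[of w] embed_val[of w'] by (simp add: cl_append cl_pow)
  then have "pres_eq A_t R_t ?u ?v"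
    using w by (simp add: word_class_eq_iff)
  then have "similar (act ?u (0, \<one>)) (act ?v (0, \<one>))"
    by (rule act_pres_eq) (use p_pos in simp)
  moreover have "act ?u (0, \<one>) = (i, g)" "act ?v (0, \<one>) = (j, g')"
    using w assms act_t_pow[of 0 i \<one>] act_t_pow[of 0 j \<one>] by (simp_all add: act_lift)
  ultimately show ?thesis by (simp add: similar_def)
qed

lemma root_extension: "root_extension G E embed \<phi> root_t p \<Delta> disps"
  by unfold_locales
    (auto simp: p_pos root_pow embed_conj embed_generated finite_disps embed_disp twisted_conj_N
      dest: embed_normal_form subsetD[OF disps_closed])

end

theorem theorem4p9:
  fixes G :: "('g, 'm) monoid_scheme"
    and A :: "'x set" and R :: "('x word \<times> 'x word) set" and f :: "'x word set \<Rightarrow> 'g"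
    and \<phi> :: "'g \<Rightarrow> 'g" and p :: nat and \<Delta> :: 'g and \<K> :: subset_class
  assumes "group G"
    and "finite_presentation G A R f"
    and "\<phi> \<in> Via G"
    and "p > 0" and "inner_by G \<Delta> (\<phi> ^^ p)"
    and "gen_conjugacy_separable \<K> (G_phi A R f \<phi> p \<Delta>)"
  shows "gen_twisted_conjugacy_separable \<K> G \<phi>"
proof -
  have "\<phi> \<in> iso G G" using assms(3) by (simp add: Via_def)
  then have phi: "\<phi> \<in> hom G G" "bij_betw \<phi> (carrier G) (carrier G)"
    by (auto simp: iso_def)
  interpret group G by fact
  interpret via_presentation G \<phi> p \<Delta> A R f
  proof unfold_locales
    show "f \<in> iso (presented_group A R) G"
      using assms(2) by (simp add: finite_presentation_def)
  qed (use phi assms(4,5) in auto)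
  show ?thesis
    using root_extension.twisted_conjugacy_separable_if[OF root_extension] assms(6)
    by (simp add: G_phi_eq)
qed

end
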